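(* Let $S:\mathbb B\to\mathbb H$. The following are equivalent: (1) $S$ is slice regular on $\mathbb B$ and $|S(p)|\le1$ for all $p\in\mathbb B$. (2) The operator $M_S:f\mapsto S\star f$ of left $\star$-multiplication by $S$ is a contraction on $\mathrm H^2$, that is, $S\star f\in\mathrm H^2$ and $\|S\star f\|_{\mathrm H^2}\le\|f\|_{\mathrm H^2}$ for all $f\in\mathrm H^2$. (3) The kernel $$K_S(p,q)=\sum_{k=0}^\infty p^k\bigl(1-S(p)\overline{S(q)}\bigr)\bar q^k$$ is positive on $\mathbb B\times\mathbb B$. (4) $S$ is slice regular on $\mathbb B$ and, writing $S(p)=\sum_{k=0}^\infty p^kS_k$, the matrix $\mathbf I-\mathbf S_n\mathbf S_n^*$ is positive semidefinite for all $n\ge0$, where $\mathbf I$ is the $(n+1)\times(n+1)$ identity matrix and $\mathbf S_n$ is the $(n+1)\times(n+1)$ lower triangular Toeplitz matrix whose $(i,j)$ entry $(0\le i,j\le n)$ is $S_{i-j}$ if $i\ge j$ and $0$ if $i<j$.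
   Context: $\mathbb H$ is the algebra of real quaternions, $\mathbb B=\{p\in\mathbb H:|p|<1\}$, and $\mathbb S$ is the unit sphere of purely imaginary quaternions; for $I\in\mathbb S$, $\mathbb C_I=\{x+Iy:x,y\in\mathbb R\}$. For $\Omega\subset\mathbb H$ open, a real differentiable function $f:\Omega\to\mathbb H$ is (left) slice regular on $\Omega$ if for every $I\in\mathbb S$ its restriction $f_I$ to $\Omega\cap\mathbb C_I$ satisfies $\frac{\partial}{\partial x}f_I(x+Iy)+I\frac{\partial}{\partial y}f_I(x+Iy)\equiv0$. The functions slice regular on $\mathbb B$ are exactly the power series $f(p)=\sum_{k\ge0}p^kf_k$, $f_k\in\mathbb H$, with radius of convergence at least one. The Hardy space is $\mathrm H^2=\{f(p)=\sum_{k\ge0}p^kf_k:\ \|f\|_{\mathrm H^2}^2:=\sum_{k\ge0}|f_k|^2<\infty\}$, a right quaternionic Hilbert space with inner product $\langle f,g\rangle=\sum_k\bar g_kf_k$. For any function $S:\mathbb B\to\mathbb H$ (no regularity assumed) and $f(p)=\sum_kp^kf_k$ slice regular on $\mathbb B$, the $\star$-product is defined pointwise by $(S\star f)(p)=\sum_{k=0}^\infty p^kS(p)f_k$; if $S(p)=\sum_kp^kS_k$ this is the convolution product $\sum_kp^k\bigl(\sum_{r=0}^kS_rf_{k-r}\bigr)$. A function $K:\Omega\times\Omega\to\mathbb H$ is a positive kernel if the matrix $[K(q_i,q_j)]_{i,j=1}^r$ is positive semidefinite for any choice of finitely many points $q_1,\ldots,q_r\in\Omega$. A Hermitian quaternionic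 matrix $A$ is positive semidefinite if $c^*Ac\ge0$ for all column vectors $c$ over $\mathbb H$. *)

theory Defs
  imports "HOL-Complex_Analysis.Complex_Analysis" "Jordan_Normal_Form.Matrix"
begin

text \<open>The infix dot is kept for \<^const>\<open>inner\<close>.\<close>

no_notation scalar_prod (infix \<open>\<bullet>\<close> 70)

section \<open>The algebra of real quaternions\<close>

codatatype quat = Quat (qRe: real) (qIm1: real) (qIm2: real) (qIm3: real)

lemma quat_eq_iff:
  "x = y \<longleftrightarrow> qRe x = qRe y \<and> qIm1 x = qIm1 y \<and> qIm2 x = qIm2 y \<and> qIm3 x = qIm3 y"
  by (auto intro: quat.expand)

instantiation quat :: ab_group_add
begin

primcorec zero_quat where
  "qRe 0 = 0" | "qIm1 0 = 0" | "qIm2 0 = 0" | "qIm3 0 = 0"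

primcorec plus_quat where
  "qRe (x + y) = qRe x + qRe y"
| "qIm1 (x + y) = qIm1 x + qIm1 y"
| "qIm2 (x + y) = qIm2 x + qIm2 y"
| "qIm3 (x + y) = qIm3 x + qIm3 y"

primcorec uminus_quat where
  "qRe (- x) = - qRe x"
| "qIm1 (- x) = - qIm1 x"
| "qIm2 (- x) = - qIm2 x"
| "qIm3 (- x) = - qIm3 x"

primcorec minus_quat where
  "qRe (x - y) = qRe x - qRe y"
| "qIm1 (x - y) = qIm1 x - qIm1 y"
| "qIm2 (x - y) = qIm2 x - qIm2 y"
| "qIm3 (x - y) = qIm3 x - qIm3 y"

instance
  by standard (simp_all add: quat_eq_iff)

end

instantiation quat :: real_algebra_1
begin

primcorec one_quat where
  "qRe 1 = 1" | "qIm1 1 = 0" | "qIm2 1 = 0" | "qIm3 1 = 0"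

primcorec times_quat where
  "qRe (x * y) = qRe x * qRe y - qIm1 x * qIm1 y - qIm2 x * qIm2 y - qIm3 x * qIm3 y"
| "qIm1 (x * y) = qRe x * qIm1 y + qIm1 x * qRe y + qIm2 x * qIm3 y - qIm3 x * qIm2 y"
| "qIm2 (x * y) = qRe x * qIm2 y - qIm1 x * qIm3 y + qIm2 x * qRe y + qIm3 x * qIm1 y"
| "qIm3 (x * y) = qRe x * qIm3 y + qIm1 x * qIm2 y - qIm2 x * qIm1 y + qIm3 x * qRe y"

primcorec scaleR_quat where
  "qRe (scaleR r x) = r * qRe x"
| "qIm1 (scaleR r x) = r * qIm1 x"
| "qIm2 (scaleR r x) = r * qIm2 x"
| "qIm3 (scaleR r x) = r * qIm3 x"

instance
  by standard (simp_all add: quat_eq_iff algebra_simps)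

end

primcorec qcnj :: "quat \<Rightarrow> quat" where
  "qRe (qcnj x) = qRe x"
| "qIm1 (qcnj x) = - qIm1 x"
| "qIm2 (qcnj x) = - qIm2 x"
| "qIm3 (qcnj x) = - qIm3 x"

instantiation quat :: real_inner
begin

definition inner_quat :: "quat \<Rightarrow> quat \<Rightarrow> real" where
  "inner_quat x y = qRe x * qRe y + qIm1 x * qIm1 y + qIm2 x * qIm2 y + qIm3 x * qIm3 y"

definition norm_quat :: "quat \<Rightarrow> real" where
  "norm_quat x = sqrt ((qRe x)\<^sup>2 + (qIm1 x)\<^sup>2 + (qIm2 x)\<^sup>2 + (qIm3 x)\<^sup>2)"

definition sgn_quat :: "quat \<Rightarrow> quat" where
  "sgn_quat x = x /\<^sub>R norm x"

definition dist_quat :: "quat \<Rightarrow> quat \<Rightarrow> real" where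
  "dist_quat x y = norm (x - y)"

definition [code del]:
  "(uniformity :: (quat \<times> quat) filter) = (INF e\<in>{0 <..}. principal {(x, y). dist x y < e})"

definition open_quat :: "quat set \<Rightarrow> bool" where [code del]:
  "open_quat U \<longleftrightarrow> (\<forall>x\<in>U. eventually (\<lambda>(x', y). x' = x \<longrightarrow> y \<in> U) uniformity)"

instance
proof
  fix r :: real and x y z :: quat and U :: "quat set"
  show "dist x y = norm (x - y)" by (rule dist_quat_def)
  show "sgn x = x /\<^sub>R norm x" by (rule sgn_quat_def)
  show "uniformity = (INF e\<in>{0 <..}. principal {(x :: quat, y). dist x y < e})"
    by (rule uniformity_quat_def)
  show "open U \<longleftrightarrow> (\<forall>x\<in>U. eventually (\<lambda>(x', y). x' = x \<longrightarrow> y \<in> U) uniformity)"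
    by (rule open_quat_def)
  show "inner x y = inner y x" by (simp add: inner_quat_def mult.commute)
  show "inner (x + y) z = inner x z + inner y z" by (simp add: inner_quat_def algebra_simps)
  show "inner (r *\<^sub>R x) y = r * inner x y" by (simp add: inner_quat_def algebra_simps)
  show "0 \<le> inner x x" by (simp add: inner_quat_def)
  show "inner x x = 0 \<longleftrightarrow> x = 0"
    by (simp add: inner_quat_def quat_eq_iff[of x] add_nonneg_eq_0_iff)
  show "norm x = sqrt (inner x x)" by (simp add: norm_quat_def inner_quat_def power2_eq_square)
qed

end

instantiation quat :: real_normed_div_algebra
begin

definition inverse_quat :: "quat \<Rightarrow> quat" where
  "inverse_quat x = qcnj x /\<^sub>R (norm x)\<^sup>2"

definition
  "x div y = x * inverse y" for x y :: quat

instance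
proof
  fix x y :: quat
  have sq: "(norm z)\<^sup>2 = qRe z * qRe z + qIm1 z * qIm1 z + qIm2 z * qIm2 z + qIm3 z * qIm3 z"
    for z :: quat
    by (simp add: norm_quat_def power2_eq_square)
  have conj: "qcnj x * x = (norm x)\<^sup>2 *\<^sub>R 1" "x * qcnj x = (norm x)\<^sup>2 *\<^sub>R 1"
    by (simp_all add: quat_eq_iff sq algebra_simps)
  show "x \<noteq> 0 \<Longrightarrow> inverse x * x = 1" and "x \<noteq> 0 \<Longrightarrow> x * inverse x = 1"
    by (simp_all add: inverse_quat_def conj)
  show "x div y = x * inverse y" by (rule divide_quat_def)
  show "inverse (0 :: quat) = 0" by (simp add: inverse_quat_def)
  have "(norm (x * y))\<^sup>2 = (norm x * norm y)\<^sup>2"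
    unfolding power_mult_distrib sq times_quat.simps by (simp add: algebra_simps)
  then show "norm (x * y) = norm x * norm y"
    by (simp add: power2_eq_iff_nonneg)
qed

end

instantiation quat :: euclidean_space
begin

definition Basis_quat :: "quat set" where
  "Basis_quat = {Quat 1 0 0 0, Quat 0 1 0 0, Quat 0 0 1 0, Quat 0 0 0 1}"

instance
proof
  show "(Basis :: quat set) \<noteq> {}" and "finite (Basis :: quat set)"
    by (simp_all add: Basis_quat_def)
  fix u v :: quat
  show "u \<in> Basis \<Longrightarrow> v \<in> Basis \<Longrightarrow> inner u v = (if u = v then 1 else 0)"
    unfolding Basis_quat_def inner_quat_def by (elim insertE emptyE) simp_all
  show "(\<forall>u\<in>Basis. inner v u = 0) \<longleftrightarrow> v = 0"
    by (simp add: Basis_quat_def inner_quat_def quat_eq_iff[of v])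
qed

end

section \<open>Slice regular functions\<close>

definition imag_units :: "quat set" where
  "imag_units = {I. qRe I = 0 \<and> norm I = 1}"

text \<open>Real differentiability (in the Frechet sense) guarantees that the two partial derivatives below
  exist, so that \<^const>\<open>vector_derivative\<close> denotes them.\<close>

definition slice_regular_on :: "(quat \<Rightarrow> quat) \<Rightarrow> quat set \<Rightarrow> bool" where
  "slice_regular_on f \<Omega> \<longleftrightarrow> open \<Omega> \<and> f differentiable_on \<Omega> \<and>
     (\<forall>I\<in>imag_units. \<forall>x y :: real. of_real x + I * of_real y \<in> \<Omega> \<longrightarrow>
        vector_derivative (\<lambda>t. f (of_real t + I * of_real y)) (at x)
        + I * vector_derivative (\<lambda>t. f (of_real x + I * of_real t)) (at y) = 0)"

abbreviation quat_ball :: "quat set" ("\<bool>") where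
  "\<bool> \<equiv> ball 0 1"

section \<open>Power series, the Hardy space and the star product\<close>

text \<open>Functions on the ball are total functions on \<^typ>\<open>quat\<close>; only their values on \<open>\<bool>\<close> are ever used.
  The coefficients \<open>f\<^sub>k\<close> stand on the right of the powers of the variable.\<close>

definition has_coeffs :: "(quat \<Rightarrow> quat) \<Rightarrow> (nat \<Rightarrow> quat) \<Rightarrow> bool" where
  "has_coeffs f a \<longleftrightarrow> (\<forall>p\<in>\<bool>. (\<lambda>k. p ^ k * a k) sums f p)"

definition coeffs_of :: "(quat \<Rightarrow> quat) \<Rightarrow> nat \<Rightarrow> quat" where
  "coeffs_of f = (THE a. has_coeffs f a)"

lemma real_powser_coeffs_zero:
  fixes c :: "nat \<Rightarrow> real"
  assumes sm: "\<And>x. \<bar>x\<bar> < 1 \<Longrightarrow> (\<lambda>k. c k * x ^ k) sums 0"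
  shows "c k = 0"
proof (rule ccontr)
  assume k: "c k \<noteq> 0"
  have "c 0 = 0"
    using sm[of 0] powser_sums_zero_iff[of c 0] by simp
  with k have "k > 0" by (cases k) auto
  show False
  proof (rule powser_0_nonzero[of 1 0 c "\<lambda>_. 0" k])
    fix s :: real assume "0 < s" and s: "\<And>z :: real. z \<in> cball 0 s - {0} \<Longrightarrow> (0 :: real) \<noteq> 0"
    then show False using s[of s] by simp
  qed (use sm k \<open>k > 0\<close> in auto)
qed

lemma coeffs_of_eq:
  assumes "has_coeffs f a"
  shows "coeffs_of f = a"
  unfolding coeffs_of_def
proof (rule the_equality[where P = "has_coeffs f", OF assms])
  fix b assume b: "has_coeffs f b"
  have bl: "bounded_linear qRe" "bounded_linear qIm1" "bounded_linear qIm2" "bounded_linear qIm3"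
    using bounded_linear_inner_left[of "Quat 1 0 0 0"] bounded_linear_inner_left[of "Quat 0 1 0 0"]
      bounded_linear_inner_left[of "Quat 0 0 1 0"] bounded_linear_inner_left[of "Quat 0 0 0 1"]
    by (simp_all add: inner_quat_def)
  have *: "(\<lambda>k. x ^ k *\<^sub>R (b k - a k)) sums 0" if "\<bar>x\<bar> < 1" for x :: real
  proof -
    have "(of_real x :: quat) \<in> \<bool>" using that by simp
    then have "(\<lambda>k. of_real x ^ k * b k - of_real x ^ k * a k) sums (f (of_real x) - f (of_real x))"
      using assms b unfolding has_coeffs_def by (intro sums_diff) auto
    then show ?thesis
      by (simp add: scaleR_conv_of_real algebra_simps)
  qed
  have "L (b k - a k) = 0" if L: "bounded_linear L" for L :: "quat \<Rightarrow> real" and k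
    using real_powser_coeffs_zero[of "\<lambda>k. L (b k - a k)" k]
      bounded_linear.sums[OF L *] bounded_linear.linear[OF L]
    by (simp add: linear_cmul linear_0 mult.commute)
  with bl show "b = a"
    by (force simp: fun_eq_iff quat_eq_iff)
qed

definition hardy_space :: "(quat \<Rightarrow> quat) set" ("H\<^sup>2") where
  "H\<^sup>2 = {f. \<exists>a. has_coeffs f a \<and> summable (\<lambda>k. (norm (a k))\<^sup>2)}"

definition hardy_norm :: "(quat \<Rightarrow> quat) \<Rightarrow> real" where
  "hardy_norm f = sqrt (\<Sum>k. (norm (coeffs_of f k))\<^sup>2)"

definition star_prod :: "(quat \<Rightarrow> quat) \<Rightarrow> (quat \<Rightarrow> quat) \<Rightarrow> quat \<Rightarrow> quat" where
  "star_prod S f p = (\<Sum>k. p ^ k * S p * coeffs_of f k)"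

definition hardy_contraction :: "((quat \<Rightarrow> quat) \<Rightarrow> quat \<Rightarrow> quat) \<Rightarrow> bool" where
  "hardy_contraction T \<longleftrightarrow> (\<forall>f\<in>H\<^sup>2. T f \<in> H\<^sup>2 \<and> hardy_norm (T f) \<le> hardy_norm f)"

section \<open>Positive semidefinite matrices and positive kernels\<close>

text \<open>The library's adjoint and Hermitian matrices need a multiplicative conjugation, whereas
  quaternionic conjugation reverses products.\<close>

definition qadjoint :: "quat mat \<Rightarrow> quat mat" where
  "qadjoint A = map_mat qcnj (transpose_mat A)"

definition qpos_semidef :: "quat mat \<Rightarrow> bool" where
  "qpos_semidef A \<longleftrightarrow> square_mat A \<and> qadjoint A = A \<and>
     (\<forall>c\<in>carrier_vec (dim_row A).
        \<exists>t\<ge>0. scalar_prod (map_vec qcnj c) (A *\<^sub>v c) = of_real t)"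

definition positive_kernel :: "quat set \<Rightarrow> (quat \<Rightarrow> quat \<Rightarrow> quat) \<Rightarrow> bool" where
  "positive_kernel \<Omega> K \<longleftrightarrow>
     (\<forall>r. \<forall>q :: nat \<Rightarrow> quat. (\<forall>i<r. q i \<in> \<Omega>) \<longrightarrow> qpos_semidef (mat r r (\<lambda>(i, j). K (q i) (q j))))"

definition schur_kernel :: "(quat \<Rightarrow> quat) \<Rightarrow> quat \<Rightarrow> quat \<Rightarrow> quat" where
  "schur_kernel S p q = (\<Sum>k. p ^ k * (1 - S p * qcnj (S q)) * qcnj q ^ k)"

definition lower_toeplitz :: "(nat \<Rightarrow> quat) \<Rightarrow> nat \<Rightarrow> quat mat" where
  "lower_toeplitz s n = mat (n + 1) (n + 1) (\<lambda>(i, j). if j \<le> i then s (i - j) else 0)"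

end

theory Submission
  imports Defs
begin

text \<open>
  All four conditions are shown to be equivalent to one condition on coefficients: \<open>S\<close> has a power
  series with coefficients \<open>s\<close>, and all finite lower triangular Toeplitz matrices of \<open>s\<close> are
  contractions (\<open>toeplitz_contractive\<close>). Slice regularity on the ball is the same as having a power
  series: on each slice a slice regular function is holomorphic, and the Taylor coefficients do not
  depend on the slice because all slices share the real axis.

  The matrix condition asks that the adjoints of the Toeplitz matrices be contractions, and a matrix is a
  contraction exactly when its adjoint is. For the operator condition, the star product convolves the
  coefficients, so the Toeplitz matrices are the finite sections of star multiplication by \<open>S\<close>. For
  the kernel condition, the quadratic form of the kernel is \<open>|g|\<^sup>2 - |t|\<^sup>2\<close>, where \<open>g\<close> is a combination of
  reproducing kernels of the Hardy space and \<open>t\<close> its image under the would-be adjoint of star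
  multiplication (\<open>positive_schur_kernel_iff\<close>). If \<open>S\<close> has a power series, \<open>t\<close> is a limit of adjoint
  Toeplitz matrices acting on truncations of \<open>g\<close>.

  Two implications need an idea.

  From a bounded \<open>S\<close> to contractive Toeplitz matrices: the modulus of \<open>S\<close> on one slice does not
  control multiplication, since values of \<open>S\<close> do not commute with the variable. If instead the
  variable is written on the right, the convolution of \<open>s\<close> and \<open>v\<close> has the generating function
  \<open>R(w p w\<^sup>-\<^sup>1) w\<close>, where \<open>w\<close> is the value at \<open>p\<close> of the generating function of \<open>v\<close> and \<open>R(p)\<close> is the
  sum of \<open>s\<^sub>m p\<^sup>m\<close>. On every sphere of quaternions with given real part and modulus, \<open>R\<close> takes values of
  the same moduli as \<open>S\<close> (\<open>norm_right_series_le_1\<close>), so \<open>|R| \<le> 1\<close>. This gives a pointwise bound on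
  circles inside a single slice, which Parseval's identity turns into the bound for the coefficients
  (\<open>bounded_imp_toeplitz_contractive\<close>).

  From a positive kernel back to a power series for an arbitrary function \<open>S\<close>: positivity makes
  \<open>\<Sum> k\<^sub>q c\<^sub>q \<mapsto> \<Sum> qcnj (S q) c\<^sub>q\<close>, the sums running over finitely many points \<open>q\<close> with kernels \<open>k\<^sub>q\<close>, a
  bounded functional for the norm of square summable sequences.
  Monomials are limits of averages of kernels over roots of unity, so the functional extends to them,
  and its values there are the conjugates of the coefficients of \<open>S\<close>
  (\<open>positive_kernel_imp_has_coeffs\<close>). The kernel at a single point then gives \<open>|S| \<le> 1\<close>.
\<close>

section \<open>Quaternion algebra\<close>

lemma qcnj_0 [simp]: "qcnj 0 = 0"
  and qcnj_1 [simp]: "qcnj 1 = 1"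
  and qcnj_qcnj [simp]: "qcnj (qcnj x) = x"
  and qcnj_add: "qcnj (x + y) = qcnj x + qcnj y"
  and qcnj_diff: "qcnj (x - y) = qcnj x - qcnj y"
  and qcnj_mult: "qcnj (x * y) = qcnj y * qcnj x"
  and qcnj_scaleR: "qcnj (r *\<^sub>R x) = r *\<^sub>R qcnj x"
  by (simp_all add: quat_eq_iff algebra_simps)

lemma norm_qcnj [simp]: "norm (qcnj x) = norm x"
  by (simp add: norm_quat_def)

lemma qcnj_power: "qcnj (x ^ n) = qcnj x ^ n"
  by (induction n) (simp_all add: qcnj_mult power_commutes)

lemma qcnj_sum: "qcnj (sum f A) = (\<Sum>x\<in>A. qcnj (f x))"
  by (induction A rule: infinite_finite_induct) (simp_all add: qcnj_add)

lemma bounded_linear_qcnj: "bounded_linear qcnj"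
  by (rule bounded_linear_intro[of _ 1]) (simp_all add: qcnj_add qcnj_scaleR)

lemma norm_sq_quat: "(norm x)\<^sup>2 = (qRe x)\<^sup>2 + (qIm1 x)\<^sup>2 + (qIm2 x)\<^sup>2 + (qIm3 x)\<^sup>2"
  by (simp add: norm_quat_def)

lemma qRe_of_real [simp]: "qRe (of_real r) = r"
  by (simp add: of_real_def)

lemma qcnj_mult_self: "qcnj x * x = of_real ((norm x)\<^sup>2)"
  and mult_qcnj_self: "x * qcnj x = of_real ((norm x)\<^sup>2)"
  by (simp_all add: quat_eq_iff of_real_def norm_sq_quat flip: power2_eq_square)

lemma inner_quat_mult_left: "inner (b * x) y = inner x (qcnj b * y)"
  for b x y :: quat
  by (simp add: inner_quat_def algebra_simps)

text \<open>Both squared norms expand to \<open>1 + 2 qRe (u * v) + (norm u * norm v)\<^sup>2\<close>, because the real part of a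
  product does not depend on the order of the two factors.\<close>

lemma norm_one_plus_mult_commute: "norm (1 + u * v) = norm (1 + v * u)" for u v :: quat
proof -
  have "(norm (1 + u * v))\<^sup>2 = 1 + 2 * qRe (u * v) + (norm (u * v))\<^sup>2"
    and "(norm (1 + v * u))\<^sup>2 = 1 + 2 * qRe (v * u) + (norm (v * u))\<^sup>2"
    by (simp_all only: norm_sq_quat) (simp_all add: power2_eq_square algebra_simps)
  moreover have "qRe (u * v) = qRe (v * u)" by (simp add: algebra_simps)
  ultimately have "(norm (1 + u * v))\<^sup>2 = (norm (1 + v * u))\<^sup>2"
    by (simp add: norm_mult mult.commute)
  then show ?thesis by (simp add: power2_eq_iff_nonneg)
qed

section \<open>Slices\<close>

text \<open>The identification of the complex plane with the slice spanned by \<open>1\<close> and \<open>I\<close>. It is an isometric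
  ring homomorphism when \<open>I\<close> is an imaginary unit, which is how complex analysis and complex roots of
  unity enter.\<close>

definition slice_emb :: "quat \<Rightarrow> complex \<Rightarrow> quat" where
  "slice_emb I z = of_real (Re z) + I * of_real (Im z)"

lemma imag_units_sq:
  assumes "I \<in> imag_units"
  shows "I * I = -1"
proof -
  have "qcnj I = - I" using assms by (simp add: imag_units_def quat_eq_iff)
  then show ?thesis
    using qcnj_mult_self[of I] assms by (simp add: imag_units_def minus_equation_iff)
qed

lemma imag_units_conjugate:
  assumes "I \<in> imag_units" "a \<noteq> 0"
  shows "a * I * inverse a \<in> imag_units"
proof -
  have "qRe (a * I * inverse a) = qRe (inverse a * (a * I))"
    by (simp add: algebra_simps)
  also have "inverse a * (a * I) = I"
    using assms(2) by (simp add: mult.assoc[symmetric])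
  finally show ?thesis
    using assms by (simp add: imag_units_def norm_mult norm_inverse)
qed

lemma imag_units_nonempty: "Quat 0 1 0 0 \<in> imag_units"
  by (simp add: imag_units_def norm_quat_def)

lemma slice_emb_add: "slice_emb I (z + w) = slice_emb I z + slice_emb I w"
  by (simp add: slice_emb_def algebra_simps)

lemma slice_emb_of_real [simp]: "slice_emb I (of_real r) = of_real r"
  by (simp add: slice_emb_def)

lemma slice_emb_0 [simp]: "slice_emb I 0 = 0" and slice_emb_1 [simp]: "slice_emb I 1 = 1"
  by (simp_all add: slice_emb_def)

lemma slice_emb_scaleR: "slice_emb I (r *\<^sub>R z) = r *\<^sub>R slice_emb I z"
  by (simp add: slice_emb_def of_real_def algebra_simps)

lemma slice_emb_mult:
  assumes "I \<in> imag_units"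
  shows "slice_emb I (z * w) = slice_emb I z * slice_emb I w"
  by (simp add: slice_emb_def of_real_def algebra_simps imag_units_sq[OF assms])

lemma slice_emb_power: "I \<in> imag_units \<Longrightarrow> slice_emb I (z ^ n) = slice_emb I z ^ n"
  by (induction n) (simp_all add: slice_emb_mult)

lemma slice_emb_sum: "slice_emb I (sum f A) = (\<Sum>x\<in>A. slice_emb I (f x))"
  by (induction A rule: infinite_finite_induct) (simp_all add: slice_emb_add)

lemma norm_slice_emb:
  assumes "I \<in> imag_units"
  shows "norm (slice_emb I z) = norm z"
proof -
  have I: "qRe I = 0" "(qIm1 I)\<^sup>2 + (qIm2 I)\<^sup>2 + (qIm3 I)\<^sup>2 = 1"
    using assms norm_sq_quat[of I] by (auto simp: imag_units_def)
  have "(norm (slice_emb I z))\<^sup>2 =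
      (Re z)\<^sup>2 + ((qIm1 I)\<^sup>2 + (qIm2 I)\<^sup>2 + (qIm3 I)\<^sup>2) * (Im z)\<^sup>2"
    by (simp add: norm_sq_quat slice_emb_def of_real_def power_mult_distrib distrib_right I(1))
  then have "(norm (slice_emb I z))\<^sup>2 = (norm z)\<^sup>2"
    by (simp add: I(2) cmod_power2)
  then show ?thesis by (simp add: power2_eq_iff_nonneg)
qed

lemma bounded_linear_slice_emb: "I \<in> imag_units \<Longrightarrow> bounded_linear (slice_emb I)"
  by (rule bounded_linear_intro[of _ 1]) (simp_all add: slice_emb_add slice_emb_scaleR norm_slice_emb)

lemma slice_emb_cnj: "I \<in> imag_units \<Longrightarrow> slice_emb I (cnj z) = qcnj (slice_emb I z)"
  by (simp add: slice_emb_def imag_units_def quat_eq_iff of_real_def)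

text \<open>Every quaternion lies on some slice: take the normalised imaginary part as the imaginary unit,
  or an arbitrary one for real quaternions.\<close>

lemma slice_embE:
  obtains I z where "I \<in> imag_units" "p = slice_emb I z"
proof (cases "p = of_real (qRe p)")
  case True
  then have "p = slice_emb (Quat 0 1 0 0) (of_real (qRe p))" by simp
  with imag_units_nonempty show ?thesis by (rule that)
next
  case False
  define v where "v = p - of_real (qRe p)"
  have "v \<noteq> 0" using False by (simp add: v_def)
  then have "v /\<^sub>R norm v \<in> imag_units"
    by (simp add: imag_units_def v_def)
  moreover have "p = slice_emb (v /\<^sub>R norm v) (Complex (qRe p) (norm v))"
    using \<open>v \<noteq> 0\<close> by (simp add: slice_emb_def of_real_def) (simp add: v_def of_real_def)
  ultimately show ?thesis by (rule that)
qed

section \<open>Contractive matrices\<close>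

text \<open>With \<open>u = B\<^sup>* c\<close> one has \<open>|u|\<^sup>2 = \<langle>c, B u\<rangle> \<le> (|c|\<^sup>2 + |B u|\<^sup>2) / 2 \<le> (|c|\<^sup>2 + |u|\<^sup>2) / 2\<close>, so the
  contractivity of \<open>B\<close> passes to its adjoint.\<close>

lemma matrix_contraction_adjoint:
  fixes B :: "nat \<Rightarrow> nat \<Rightarrow> quat"
  assumes B: "\<And>v. (\<Sum>i<n. (norm (\<Sum>j<n. B i j * v j))\<^sup>2) \<le> (\<Sum>j<n. (norm (v j))\<^sup>2)"
  shows "(\<Sum>j<n. (norm (\<Sum>i<n. qcnj (B i j) * c i))\<^sup>2) \<le> (\<Sum>i<n. (norm (c i))\<^sup>2)"
proof -
  define u where "u = (\<lambda>j. \<Sum>i<n. qcnj (B i j) * c i)"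
  define b where "b = (\<lambda>i. \<Sum>j<n. B i j * u j)"
  have "(\<Sum>j<n. (norm (u j))\<^sup>2) = (\<Sum>j<n. inner (u j) (u j))"
    by (simp add: power2_norm_eq_inner)
  also have "\<dots> = (\<Sum>j<n. \<Sum>i<n. inner (c i) (B i j * u j))"
    by (subst (1) u_def) (simp add: inner_sum_left inner_quat_mult_left)
  also have "\<dots> = (\<Sum>i<n. inner (c i) (b i))"
    unfolding b_def by (subst sum.swap) (simp add: inner_sum_right)
  also have "\<dots> \<le> (\<Sum>i<n. ((norm (c i))\<^sup>2 + (norm (b i))\<^sup>2) / 2)"
  proof (rule sum_mono)
    fix i
    have "0 \<le> (norm (c i - b i))\<^sup>2" by simp
    then show "inner (c i) (b i) \<le> ((norm (c i))\<^sup>2 + (norm (b i))\<^sup>2) / 2"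
      by (simp add: power2_norm_eq_inner inner_diff_left inner_diff_right inner_commute)
  qed
  also have "\<dots> = ((\<Sum>i<n. (norm (c i))\<^sup>2) + (\<Sum>i<n. (norm (b i))\<^sup>2)) / 2"
    by (simp add: sum.distrib flip: sum_divide_distrib)
  finally show ?thesis
    using B[of u] unfolding b_def u_def by simp
qed

text \<open>The quadratic form of \<open>1 - L L\<^sup>*\<close> at \<open>c\<close> is \<open>|c|\<^sup>2 - |L\<^sup>* c|\<^sup>2\<close>.\<close>

lemma qpos_semidef_diff_mult_adjoint_iff:
  assumes L: "L \<in> carrier_mat n n"
  shows "qpos_semidef (1\<^sub>m n - L * qadjoint L) \<longleftrightarrow>
    (\<forall>c. (\<Sum>j<n. (norm (\<Sum>i<n. qcnj (L $$ (i, j)) * c i))\<^sup>2) \<le> (\<Sum>i<n. (norm (c i))\<^sup>2))"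
proof -
  define A where "A = 1\<^sub>m n - L * qadjoint L"
  have La: "qadjoint L \<in> carrier_mat n n" using L by (simp add: qadjoint_def)
  have A: "A \<in> carrier_mat n n" unfolding A_def using mult_carrier_mat[OF L La] by (rule minus_carrier_mat)
  have herm: "qadjoint A = A"
    using L by (intro eq_matI)
      (auto simp: A_def qadjoint_def scalar_prod_def qcnj_diff qcnj_sum qcnj_mult)
  have form: "scalar_prod (map_vec qcnj c) (A *\<^sub>v c) =
      of_real ((\<Sum>i<n. (norm (c $ i))\<^sup>2) - (\<Sum>j<n. (norm (\<Sum>i<n. qcnj (L $$ (i, j)) * c $ i))\<^sup>2))"
    if c: "c \<in> carrier_vec n" for c
  proof -
    have "A *\<^sub>v c = c - L *\<^sub>v (qadjoint L *\<^sub>v c)"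
      unfolding A_def using L La c by (subst minus_mult_distrib_mat_vec[of _ n n]) auto
    moreover have "(qadjoint L *\<^sub>v c) $ j = (\<Sum>i<n. qcnj (L $$ (i, j)) * c $ i)" if "j < n" for j
      using that L c by (simp add: qadjoint_def scalar_prod_def lessThan_atLeast0)
    moreover define u where "u = (\<lambda>j. \<Sum>i<n. qcnj (L $$ (i, j)) * c $ i)"
    ultimately have Ac: "(A *\<^sub>v c) $ i = c $ i - (\<Sum>j<n. L $$ (i, j) * u j)" if "i < n" for i
      using that L La c by (simp add: scalar_prod_def lessThan_atLeast0)
    have "scalar_prod (map_vec qcnj c) (A *\<^sub>v c) = (\<Sum>i<n. qcnj (c $ i) * (A *\<^sub>v c) $ i)"
      using c A by (simp add: scalar_prod_def lessThan_atLeast0 del: index_mult_mat_vec)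
    also have "\<dots> = (\<Sum>i<n. qcnj (c $ i) * c $ i) - (\<Sum>i<n. \<Sum>j<n. qcnj (c $ i) * L $$ (i, j) * u j)"
      by (simp add: Ac right_diff_distrib sum_subtractf sum_distrib_left mult.assoc)
    also have "(\<Sum>i<n. \<Sum>j<n. qcnj (c $ i) * L $$ (i, j) * u j) = (\<Sum>j<n. qcnj (u j) * u j)"
      by (subst sum.swap) (simp add: u_def qcnj_sum qcnj_mult sum_distrib_right)
    finally show ?thesis by (simp add: qcnj_mult_self u_def)
  qed
  have "qpos_semidef A \<longleftrightarrow> (\<forall>c\<in>carrier_vec n.
      (\<Sum>j<n. (norm (\<Sum>i<n. qcnj (L $$ (i, j)) * c $ i))\<^sup>2) \<le> (\<Sum>i<n. (norm (c $ i))\<^sup>2))"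
    using A by (simp add: qpos_semidef_def herm form carrier_matD del: of_real_diff of_real_sum of_real_power) 
  also have "\<dots> \<longleftrightarrow> (\<forall>c. (\<Sum>j<n. (norm (\<Sum>i<n. qcnj (L $$ (i, j)) * c i))\<^sup>2) \<le> (\<Sum>i<n. (norm (c i))\<^sup>2))"
    (is "?V \<longleftrightarrow> ?F")
  proof
    assume V: ?V
    show ?F
    proof
      fix c show "(\<Sum>j<n. (norm (\<Sum>i<n. qcnj (L $$ (i, j)) * c i))\<^sup>2) \<le> (\<Sum>i<n. (norm (c i))\<^sup>2)"
        using V[rule_format, of "vec n c"] by simp
    qed
  qed blast
  finally show ?thesis unfolding A_def .
qed

section \<open>Slice regular functions are power series\<close>

text \<open>Real numbers lie on every slice. This is what makes the power series expansions found on
  different slices agree.\<close>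

lemma real_axis_coeffs_unique:
  fixes a b :: "nat \<Rightarrow> quat"
  assumes a: "\<And>x :: real. \<bar>x\<bar> < 1 \<Longrightarrow> (\<lambda>k. of_real x ^ k * a k) sums f x"
    and b: "\<And>x :: real. \<bar>x\<bar> < 1 \<Longrightarrow> (\<lambda>k. of_real x ^ k * b k) sums f x"
  shows "a = b"
proof
  fix k
  have "(\<lambda>j. inner (a j - b j) (a k - b k) * x ^ j) sums 0" if "\<bar>x\<bar> < 1" for x :: real
  proof -
    have "(\<lambda>j. of_real x ^ j * a j - of_real x ^ j * b j) sums 0"
      using sums_diff[OF a[OF that] b[OF that]] by simp
    then have "(\<lambda>j. x ^ j *\<^sub>R (a j - b j)) sums 0"
      by (simp add: scaleR_conv_of_real algebra_simps)
    from bounded_linear.sums[OF bounded_linear_inner_left this, of "a k - b k"] show ?thesis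
      by (simp add: mult.commute)
  qed
  from real_powser_coeffs_zero[OF this, of k] show "a k = b k" by simp
qed

text \<open>Left multiplication by \<open>I\<close> turns the quaternions into a complex vector space. For each \<open>w\<close> this
  is the complex linear functional on that space whose real part is the inner product with \<open>w\<close>.\<close>

definition slice_coord :: "quat \<Rightarrow> quat \<Rightarrow> quat \<Rightarrow> complex" where
  "slice_coord I w q = Complex (inner q w) (- inner (I * q) w)"

lemma bounded_linear_slice_coord: "bounded_linear (slice_coord I w)"
proof -
  have "bounded_linear (\<lambda>q. of_real (inner q w) - \<i> * of_real (inner (I * q) w) :: complex)"
    by (intro bounded_linear_sub bounded_linear_const_mult bounded_linear_compose[OF bounded_linear_of_real]
        bounded_linear_inner_left bounded_linear_compose[OF bounded_linear_inner_left bounded_linear_mult_right])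
  moreover have "(\<lambda>q. of_real (inner q w) - \<i> * of_real (inner (I * q) w) :: complex) = slice_coord I w"
    by (simp add: slice_coord_def fun_eq_iff complex_eq_iff)
  ultimately show ?thesis by simp
qed

lemma slice_coord_mult:
  assumes "I \<in> imag_units"
  shows "slice_coord I w (slice_emb I z * q) = z * slice_coord I w q"
proof -
  have I: "I * (I * x) = - x" for x
    using imag_units_sq[OF assms] by (simp add: mult.assoc[symmetric])
  have "slice_emb I z * q = Re z *\<^sub>R q + Im z *\<^sub>R (I * q)"
    by (simp add: slice_emb_def of_real_def algebra_simps)
  moreover have "I * (slice_emb I z * q) = Re z *\<^sub>R (I * q) - Im z *\<^sub>R q"
    by (simp add: slice_emb_def of_real_def algebra_simps I)
  ultimately show ?thesis
    by (simp add: slice_coord_def complex_eq_iff inner_add_left inner_diff_left)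
qed

text \<open>Letting \<open>w\<close> run over a real basis counts every quaternion twice, once as \<open>q\<close> and once as
  \<open>- I (I q)\<close>.\<close>

lemma sum_slice_coord:
  assumes "I \<in> imag_units"
  shows "(\<Sum>w\<in>Basis. slice_emb I (slice_coord I w q) * w) = 2 *\<^sub>R q"
proof -
  have I: "I * (I * x) = - x" for x
    using imag_units_sq[OF assms] by (simp add: mult.assoc[symmetric])
  have "(\<Sum>w\<in>Basis. slice_emb I (slice_coord I w q) * w) =
      (\<Sum>w\<in>Basis. inner q w *\<^sub>R w) - I * (\<Sum>w\<in>Basis. inner (I * q) w *\<^sub>R w)"
    by (simp add: slice_emb_def slice_coord_def of_real_def sum_subtractf sum_distrib_left algebra_simps)
  then show ?thesis
    by (simp add: euclidean_representation I scaleR_2)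
qed

lemma has_vector_derivative_slice:
  fixes S :: "quat \<Rightarrow> quat"
  assumes "(S has_derivative D) (at (of_real x + I * of_real y))"
  shows "((\<lambda>t. S (of_real t + I * of_real y)) has_vector_derivative D 1) (at x)"
    and "((\<lambda>t. S (of_real x + I * of_real t)) has_vector_derivative D I) (at y)"
proof -
  have lin: "linear D" using assms by (rule has_derivative_linear)
  have "((\<lambda>t::real. of_real t + I * of_real y) has_derivative (\<lambda>h. of_real h)) (at x)"
    by (auto intro!: derivative_eq_intros)
  from diff_chain_at[OF this assms]
  show "((\<lambda>t. S (of_real t + I * of_real y)) has_vector_derivative D 1) (at x)"
    by (simp add: has_vector_derivative_def o_def of_real_def linear_cmul[OF lin])
  have "((\<lambda>t::real. of_real x + I * of_real t) has_derivative (\<lambda>h. 0 + I * of_real h)) (at y)"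
    using bounded_linear_compose[OF bounded_linear_mult_right[of I] bounded_linear_of_real]
    by (intro has_derivative_add has_derivative_const bounded_linear_imp_has_derivative) simp
  from diff_chain_at[OF this assms]
  show "((\<lambda>t. S (of_real x + I * of_real t)) has_vector_derivative D I) (at y)"
    by (simp add: has_vector_derivative_def o_def of_real_def linear_cmul[OF lin])
qed

text \<open>The slice equation says that the real derivative of \<open>S\<close> along the slice commutes with left
  multiplication by \<open>I\<close>, that is, that it is complex linear.\<close>

lemma slice_regular_imp_holomorphic_coord:
  assumes S: "slice_regular_on S \<bool>" and I: "I \<in> imag_units"
  shows "(\<lambda>z. slice_coord I w (S (slice_emb I z))) holomorphic_on ball 0 1"
proof -
  have "\<exists>c. ((\<lambda>z. slice_coord I w (S (slice_emb I z))) has_field_derivative c) (at z)"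
    if "z \<in> ball 0 1" for z
  proof -
    have p: "slice_emb I z \<in> \<bool>" using that by (simp add: norm_slice_emb[OF I])
    then have "S differentiable (at (slice_emb I z))"
      using S by (auto simp: slice_regular_on_def differentiable_on_def at_within_open[OF _ open_ball])
    then obtain D where D: "(S has_derivative D) (at (slice_emb I z))"
      by (auto simp: differentiable_def)
    then have D': "(S has_derivative D) (at (of_real (Re z) + I * of_real (Im z)))"
      by (simp add: slice_emb_def)
    have lin: "linear D" using D by (rule has_derivative_linear)
    have "vector_derivative (\<lambda>t. S (of_real t + I * of_real (Im z))) (at (Re z))
        + I * vector_derivative (\<lambda>t. S (of_real (Re z) + I * of_real t)) (at (Im z)) = 0"
      using S I p unfolding slice_regular_on_def slice_emb_def by blast
    then have "D 1 + I * D I = 0"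
      by (simp only: has_vector_derivative_slice[OF D', THEN vector_derivative_at])
    then have "I * (D 1 + I * D I) = 0" by simp
    then have DI: "D I = I * D 1"
      using imag_units_sq[OF I] by (simp add: distrib_left flip: mult.assoc)
    have Dh: "D (slice_emb I h) = slice_emb I h * D 1" for h
    proof -
      have "slice_emb I h = Re h *\<^sub>R 1 + Im h *\<^sub>R I" by (simp add: slice_emb_def of_real_def)
      then show ?thesis
        by (simp add: linear_add[OF lin] linear_cmul[OF lin] DI distrib_right)
    qed
    have "((\<lambda>z. slice_coord I w (S (slice_emb I z))) has_derivative
        (\<lambda>h. slice_coord I w (D (slice_emb I h)))) (at z)"
      using bounded_linear.has_derivative[OF bounded_linear_slice_coord
          diff_chain_at[OF bounded_linear_imp_has_derivative[OF bounded_linear_slice_emb[OF I]] D]]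
      by (simp add: o_def)
    then show ?thesis
      by (intro exI[of _ "slice_coord I w (D 1)"])
        (simp add: has_field_derivative_def Dh slice_coord_mult[OF I] mult_commute_abs)
  qed
  then show ?thesis
    by (subst holomorphic_on_open) auto
qed

text \<open>The Taylor series of the complex coordinates are put together with
  \<open>sum_slice_coord\<close>.\<close>

lemma slice_regular_imp_slice_series:
  assumes S: "slice_regular_on S \<bool>" and I: "I \<in> imag_units"
  shows "\<exists>a. \<forall>z. norm z < 1 \<longrightarrow> (\<lambda>k. slice_emb I z ^ k * a k) sums S (slice_emb I z)"
proof -
  define F where "F = (\<lambda>w z. slice_coord I w (S (slice_emb I z)))"
  define c where "c = (\<lambda>w k. (deriv ^^ k) (F w) 0 / fact k)"
  define a where "a = (\<lambda>k. (1/2) *\<^sub>R (\<Sum>w\<in>Basis. slice_emb I (c w k) * w))"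
  have "(\<lambda>k. slice_emb I z ^ k * a k) sums S (slice_emb I z)" if z: "norm z < 1" for z
  proof -
    have "(\<lambda>k. c w k * z ^ k) sums F w z" for w
      using holomorphic_power_series[OF slice_regular_imp_holomorphic_coord[OF S I], of z w] z
      by (simp add: F_def c_def)
    then have "(\<lambda>k. slice_emb I (c w k * z ^ k) * w) sums (slice_emb I (F w z) * w)" for w
      by (intro sums_mult2 bounded_linear.sums[OF bounded_linear_slice_emb[OF I]])
    then have "(\<lambda>k. (1/2) *\<^sub>R (\<Sum>w\<in>Basis. slice_emb I (c w k * z ^ k) * w)) sums
        ((1/2) *\<^sub>R (\<Sum>w\<in>Basis. slice_emb I (F w z) * w))"
      by (intro sums_scaleR_right sums_sum)
    moreover have "slice_emb I z ^ k * a k = (1/2) *\<^sub>R (\<Sum>w\<in>Basis. slice_emb I (c w k * z ^ k) * w)" for k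
      by (simp add: a_def sum_distrib_left mult.commute[of _ "z ^ k"] slice_emb_mult[OF I]
          slice_emb_power[OF I] mult.assoc)
    ultimately show ?thesis
      by (simp add: F_def sum_slice_coord[OF I])
  qed
  then show ?thesis by blast
qed

theorem slice_regular_imp_has_coeffs:
  assumes S: "slice_regular_on S \<bool>"
  shows "\<exists>a. has_coeffs S a"
proof -
  obtain a where a: "\<And>I z. I \<in> imag_units \<Longrightarrow> norm z < 1 \<Longrightarrow>
      (\<lambda>k. slice_emb I z ^ k * a I k) sums S (slice_emb I z)"
    using slice_regular_imp_slice_series[OF S] by metis
  have real: "(\<lambda>k. of_real x ^ k * a I k) sums S (of_real x)"
    if "\<bar>x\<bar> < 1" "I \<in> imag_units" for x I
    using a[of I "of_real x"] that by simp
  define b where "b = a (Quat 0 1 0 0)"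
  have eq: "a I = b" if I: "I \<in> imag_units" for I
    unfolding b_def
    by (rule real_axis_coeffs_unique[where f = "\<lambda>x. S (of_real x)"]) (simp_all add: real I imag_units_nonempty)
  have "has_coeffs S b"
    unfolding has_coeffs_def
  proof
    fix p assume "p \<in> \<bool>"
    moreover obtain I z where "I \<in> imag_units" "p = slice_emb I z" by (rule slice_embE)
    ultimately show "(\<lambda>k. p ^ k * b k) sums S p"
      using a[of I z] eq[of I] by (simp add: norm_slice_emb)
  qed
  then show ?thesis by blast
qed

section \<open>Power series are slice regular\<close>

lemma has_coeffs_summable_norm:
  assumes a: "has_coeffs f a" and r: "0 \<le> r" "r < 1"
  shows "summable (\<lambda>k. norm (a k) * r ^ k)"
proof -
  obtain s where s: "r < s" "s < 1" using r dense by blast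
  then have "summable (\<lambda>k. of_real s ^ k * a k)"
    using a r by (auto simp: has_coeffs_def sums_iff)
  then have "summable (\<lambda>k. a k * of_real s ^ k)"
    by (simp add: of_real_def mult.commute scaleR_power flip: of_real_power)
  from powser_insidea[OF this, of "of_real r"] s r show ?thesis
    by (simp add: norm_mult norm_power)
qed

text \<open>The derivative of the \<open>k\<close>-th power at \<open>p\<close> in the direction \<open>h\<close>; since \<open>h\<close> need not commute with \<open>p\<close>,
  it is not \<open>k p\<^sup>k\<^sup>-\<^sup>1 h\<close>.\<close>

definition power_deriv :: "nat \<Rightarrow> quat \<Rightarrow> quat \<Rightarrow> quat" where
  "power_deriv k p h = (\<Sum>i<k. p ^ i * h * p ^ (k - Suc i))"

lemma has_derivative_power_deriv: "((\<lambda>p. p ^ k) has_derivative power_deriv k p) (at p within A)"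
proof (induction k)
  case 0
  then show ?case by (simp add: power_deriv_def)
next
  case (Suc k)
  have "((\<lambda>p. p * p ^ k) has_derivative (\<lambda>h. p * power_deriv k p h + h * p ^ k)) (at p within A)"
    by (rule has_derivative_mult[OF has_derivative_ident Suc])
  moreover have "p * power_deriv k p h + h * p ^ k = power_deriv (Suc k) p h" for h
    unfolding power_deriv_def sum.lessThan_Suc_shift by (simp add: sum_distrib_left mult.assoc)
  ultimately show ?case by simp
qed

lemma norm_power_deriv_le:
  assumes "norm p \<le> r"
  shows "norm (power_deriv k p h) \<le> real k * r ^ (k - 1) * norm h"
proof -
  have "norm (p ^ i * h * p ^ (k - Suc i)) \<le> r ^ (k - 1) * norm h" if "i < k" for i
  proof -
    have "norm (p ^ i * h * p ^ (k - Suc i)) = norm p ^ (i + (k - Suc i)) * norm h"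
      by (simp add: norm_mult norm_power power_add)
    also have "i + (k - Suc i) = k - 1" using that by simp
    finally show ?thesis using assms by (simp add: mult_right_mono power_mono)
  qed
  then have "norm (power_deriv k p h) \<le> (\<Sum>i<k. r ^ (k - 1) * norm h)"
    unfolding power_deriv_def by (intro sum_norm_le) simp
  then show ?thesis by simp
qed

lemma has_coeffs_summable_deriv:
  assumes a: "has_coeffs f a" and r: "0 \<le> r" "r < 1"
  shows "summable (\<lambda>k. real k * r ^ (k - 1) * norm (a k))"
proof -
  have "summable (\<lambda>n. norm (a n) * x ^ n)" if "norm x < 1" for x :: real
    by (rule summable_norm_cancel) (use has_coeffs_summable_norm[OF a, of "\<bar>x\<bar>"] that in \<open>simp add: abs_mult power_abs\<close>)
  then have "summable (\<lambda>n. diffs (\<lambda>n. norm (a n)) n * r ^ n)"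
    using r by (intro termdiff_converges[of r 1]) auto
  then have "summable (\<lambda>n. real (Suc n) * r ^ (Suc n - 1) * norm (a (Suc n)))"
    by (simp add: diffs_def mult.commute mult.left_commute)
  then show ?thesis
    by (rule summable_Suc_iff[of "\<lambda>k. real k * r ^ (k - 1) * norm (a k)", THEN iffD1])
qed

text \<open>Term by term differentiation on a smaller ball of radius \<open>r\<close>, where the derivatives of the terms
  are dominated by the summable sequence \<open>k r\<^sup>k\<^sup>-\<^sup>1 |a\<^sub>k|\<close>.\<close>

lemma has_coeffs_has_derivative:
  assumes a: "has_coeffs f a" and p: "p \<in> \<bool>"
  shows "summable (\<lambda>k. power_deriv k p h * a k)"
    and "(f has_derivative (\<lambda>h. \<Sum>k. power_deriv k p h * a k)) (at p)"
proof -
  obtain r where r: "norm p < r" "r < 1" using p dense by auto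
  have r0: "0 \<le> r" using r norm_ge_zero[of p] by linarith
  define M where "M = (\<lambda>k. real k * r ^ (k - 1) * norm (a k))"
  have M: "summable M" unfolding M_def using has_coeffs_summable_deriv[OF a r0 r(2)] .
  have le: "norm (power_deriv k x h * a k) \<le> M k * norm h" if "norm x < r" for k x h
    using mult_right_mono[OF norm_power_deriv_le[of x r k h], of "norm (a k)"] that
    by (simp add: norm_mult M_def algebra_simps)
  have sm: "summable (\<lambda>k. power_deriv k x h * a k)" if "norm x < r" for x h
    by (rule summable_comparison_test'[OF summable_mult2[OF M, of "norm h"]]) (use le that in auto)
  show "summable (\<lambda>k. power_deriv k p h * a k)" using sm r by blast
  have "\<exists>g. \<forall>x\<in>ball 0 r. (\<lambda>k. x ^ k * a k) sums g x \<and>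
      (g has_derivative (\<lambda>h. \<Sum>k. power_deriv k x h * a k)) (at x within ball 0 r)"
  proof (rule has_derivative_series)
    show "((\<lambda>x. x ^ k * a k) has_derivative (\<lambda>h. power_deriv k x h * a k)) (at x within ball 0 r)" for k x
      by (rule has_derivative_mult_left[OF has_derivative_power_deriv])
    show "\<forall>\<^sub>F n in sequentially. \<forall>x\<in>ball 0 r. \<forall>h.
        norm ((\<Sum>i<n. power_deriv i x h * a i) - (\<Sum>k. power_deriv k x h * a k)) \<le> e * norm h"
      if e: "e > 0" for e
    proof -
      obtain N where N: "\<And>n. n \<ge> N \<Longrightarrow> norm (\<Sum>i. M (i + n)) < e"
        using suminf_exist_split[OF e M] by blast
      have "norm ((\<Sum>i<n. power_deriv i x h * a i) - (\<Sum>k. power_deriv k x h * a k)) \<le> e * norm h"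
        if "n \<ge> N" "norm x < r" for n x h
      proof -
        have "norm ((\<Sum>i<n. power_deriv i x h * a i) - (\<Sum>k. power_deriv k x h * a k)) =
            norm (\<Sum>k. power_deriv (k + n) x h * a (k + n))"
          unfolding suminf_minus_initial_segment[OF sm[OF \<open>norm x < r\<close>, of h]]
          by (rule norm_minus_commute)
        also have "\<dots> \<le> (\<Sum>k. M (k + n) * norm h)"
          by (rule norm_suminf_le) (use le that M in \<open>auto intro: summable_mult2 summable_ignore_initial_segment\<close>)
        also have "\<dots> = (\<Sum>k. M (k + n)) * norm h"
          using M by (subst suminf_mult2) (auto intro: summable_ignore_initial_segment)
        also have "\<dots> \<le> e * norm h"
          using N[OF that(1)] by (intro mult_right_mono) auto
        finally show ?thesis .
      qed
      then show ?thesis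
        unfolding eventually_sequentially by (intro exI[of _ N]) auto
    qed
    show "p \<in> ball 0 r" using r by simp
    show "(\<lambda>k. p ^ k * a k) sums f p" using a p by (simp add: has_coeffs_def)
  qed simp
  then obtain g where "\<forall>x\<in>ball 0 r. (\<lambda>k. x ^ k * a k) sums g x \<and>
      (g has_derivative (\<lambda>h. \<Sum>k. power_deriv k x h * a k)) (at x within ball 0 r)"
    by blast
  then have g: "\<And>x. norm x < r \<Longrightarrow> (\<lambda>k. x ^ k * a k) sums g x"
    "\<And>x. norm x < r \<Longrightarrow> (g has_derivative (\<lambda>h. \<Sum>k. power_deriv k x h * a k)) (at x)"
    by (auto simp: at_within_open[OF _ open_ball])
  have gf: "g x = f x" if "x \<in> ball 0 r" for x
  proof (rule sums_unique2)
    show "(\<lambda>k. x ^ k * a k) sums g x" using that by (intro g(1)) simp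
    show "(\<lambda>k. x ^ k * a k) sums f x" using that r a by (simp add: has_coeffs_def)
  qed
  show "(f has_derivative (\<lambda>h. \<Sum>k. power_deriv k p h * a k)) (at p)"
    by (rule has_derivative_transform_within_open[OF g(2)[OF r(1)] open_ball[of 0 r] _ gf]) (use r in auto)
qed

text \<open>A point \<open>p\<close> of the slice through \<open>I\<close> commutes with \<open>I\<close>, so the derivative in the direction \<open>I\<close> is \<open>I\<close>
  times the derivative in the direction \<open>1\<close>.\<close>

theorem has_coeffs_imp_slice_regular:
  assumes a: "has_coeffs f a"
  shows "slice_regular_on f \<bool>"
  unfolding slice_regular_on_def
proof (intro conjI ballI allI impI)
  show "f differentiable_on \<bool>"
    unfolding differentiable_on_def
    by (rule ballI, rule differentiable_at_withinI, rule differentiableI,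
        rule has_coeffs_has_derivative(2)[OF a])
  fix I x y
  assume I: "I \<in> imag_units" and "of_real x + I * of_real y \<in> \<bool>"
  moreover define p where "p = of_real x + I * of_real y"
  ultimately have p: "p \<in> \<bool>" by (simp only:)
  define D where "D = (\<lambda>h. \<Sum>k. power_deriv k p h * a k)"
  have "p * I = I * p" by (simp add: p_def of_real_def distrib_left distrib_right)
  then have "p ^ i * I = I * p ^ i" for i
    by (rule power_commuting_commutes)
  then have pd: "power_deriv k p I = I * power_deriv k p 1" for k
    by (simp add: power_deriv_def sum_distrib_left mult.assoc[symmetric])
  have "D I = I * D 1"
    unfolding D_def pd mult.assoc by (rule suminf_mult[OF has_coeffs_has_derivative(1)[OF a p]])
  then have "D 1 + I * D I = 0"
    using imag_units_sq[OF I] by (simp flip: mult.assoc)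
  have "(f has_derivative D) (at (of_real x + I * of_real y))"
    using has_coeffs_has_derivative(2)[OF a p] unfolding D_def p_def .
  from has_vector_derivative_slice[OF this, THEN vector_derivative_at]
  show "vector_derivative (\<lambda>t. f (of_real t + I * of_real y)) (at x)
      + I * vector_derivative (\<lambda>t. f (of_real x + I * of_real t)) (at y) = 0"
    using \<open>D 1 + I * D I = 0\<close> by simp
qed simp

section \<open>Discrete Fourier analysis over the quaternions\<close>

text \<open>Only the orthogonality of the characters of the cyclic group of order \<open>N\<close> matters below, not
  which root of unity is used.\<close>

definition fourier_root :: "nat \<Rightarrow> quat \<Rightarrow> bool" where
  "fourier_root N \<omega> \<longleftrightarrow> norm \<omega> = 1 \<and>
     (\<forall>k<N. \<forall>r<N. (\<Sum>j<N. \<omega> ^ (j * k) * qcnj \<omega> ^ (j * r)) = (if k = r then of_nat N else 0))"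

text \<open>A primitive complex root of unity, placed on a slice; orthogonality is the geometric sum.\<close>

lemma fourier_root_exists:
  assumes "N > 0"
  shows "\<exists>\<omega>. fourier_root N \<omega>"
proof -
  define w where "w = exp (2 * of_real pi * \<i> * of_nat 1 / of_nat N)"
  have wN: "w ^ N = 1" using assms complex_root_unity[of N 1] by (simp add: w_def)
  have norm_w: "norm w = 1" by (simp add: w_def)
  have pow: "w ^ k = exp (2 * of_real pi * \<i> * of_nat k / of_nat N)" for k
    by (simp add: w_def algebra_simps flip: exp_of_nat_mult)
  have cnj_w: "w ^ k * cnj w ^ k = 1" for k
    using norm_w by (simp add: complex_norm_square[symmetric] flip: power_mult_distrib)
  have orth: "(\<Sum>j<N. w ^ (j * k) * cnj w ^ (j * r)) = (if k = r then of_nat N else 0)"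
    if "k < N" "r < N" for k r
  proof -
    define c where "c = w ^ k * cnj w ^ r"
    have terms: "w ^ (j * k) * cnj w ^ (j * r) = c ^ j" for j
      by (simp add: c_def power_mult_distrib mult.commute flip: power_mult)
    have "c = 1 \<longleftrightarrow> k = r"
    proof
      assume "c = 1"
      then have "w ^ k * (w ^ r * cnj w ^ r) = w ^ r" by (simp add: c_def mult_ac)
      then have "w ^ k = w ^ r" by (simp add: cnj_w)
      then have "k mod N = r mod N" using assms complex_root_unity_eq[of N k r] by (simp add: pow)
      then show "k = r" using that by simp
    qed (simp add: c_def cnj_w)
    moreover have "c ^ N = 1"
    proof -
      have "c ^ N = (w ^ N) ^ k * cnj ((w ^ N) ^ r)"
        by (simp add: c_def power_mult_distrib mult.commute flip: power_mult)
      then show ?thesis by (simp add: wN)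
    qed
    ultimately show ?thesis
      unfolding terms by (cases "c = 1") (simp_all add: geometric_sum)
  qed
  define I where "I = Quat 0 1 0 0"
  have I: "I \<in> imag_units" by (simp add: I_def imag_units_nonempty)
  have "fourier_root N (slice_emb I w)"
    unfolding fourier_root_def
  proof (intro conjI allI impI)
    show "norm (slice_emb I w) = 1" using norm_w by (simp add: norm_slice_emb[OF I])
    fix k r assume "k < N" "r < N"
    from arg_cong[OF orth[OF this], of "slice_emb I"]
    show "(\<Sum>j<N. slice_emb I w ^ (j * k) * qcnj (slice_emb I w) ^ (j * r)) = (if k = r then of_nat N else 0)"
      using slice_emb_of_real[of I "real N"]
      by (simp add: slice_emb_sum slice_emb_mult[OF I] slice_emb_power[OF I] slice_emb_cnj[OF I] split: if_splits)
  qed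
  then show ?thesis ..
qed

lemma qcnj_power_commute: "qcnj x ^ m * x ^ n = x ^ n * qcnj x ^ m"
proof -
  have "x * qcnj x = qcnj x * x" by (simp add: mult_qcnj_self qcnj_mult_self)
  then have "x ^ n * qcnj x = qcnj x * x ^ n" by (rule power_commuting_commutes)
  then show ?thesis by (metis power_commuting_commutes)
qed

lemma fourier_parseval:
  assumes "fourier_root N \<omega>"
  shows "(\<Sum>r<N. (norm (\<Sum>j<N. x j * qcnj \<omega> ^ (j * r)))\<^sup>2) = real N * (\<Sum>j<N. (norm (x j))\<^sup>2)"
proof -
  have orth: "(\<Sum>r<N. qcnj \<omega> ^ (j * r) * \<omega> ^ (l * r)) = (if l = j then of_nat N else 0)"
    if "j < N" "l < N" for j l
  proof -
    have "(\<Sum>r<N. qcnj \<omega> ^ (j * r) * \<omega> ^ (l * r)) = (\<Sum>r<N. \<omega> ^ (r * l) * qcnj \<omega> ^ (r * j))"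
      by (simp add: qcnj_power_commute mult.commute)
    then show ?thesis using assms that by (simp add: fourier_root_def)
  qed
  have "(of_real (\<Sum>r<N. (norm (\<Sum>j<N. x j * qcnj \<omega> ^ (j * r)))\<^sup>2) :: quat) =
      (\<Sum>r<N. (\<Sum>j<N. x j * qcnj \<omega> ^ (j * r)) * qcnj (\<Sum>l<N. x l * qcnj \<omega> ^ (l * r)))"
    by (simp add: mult_qcnj_self)
  also have "\<dots> = (\<Sum>r<N. \<Sum>j<N. \<Sum>l<N. x j * (qcnj \<omega> ^ (j * r) * \<omega> ^ (l * r)) * qcnj (x l))"
    by (simp add: qcnj_sum qcnj_mult qcnj_power sum_product mult.assoc)
  also have "\<dots> = (\<Sum>j<N. \<Sum>l<N. \<Sum>r<N. x j * (qcnj \<omega> ^ (j * r) * \<omega> ^ (l * r)) * qcnj (x l))"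
    by (subst sum.swap) (intro sum.cong refl sum.swap)
  also have "\<dots> = (\<Sum>j<N. \<Sum>l<N. x j * (\<Sum>r<N. qcnj \<omega> ^ (j * r) * \<omega> ^ (l * r)) * qcnj (x l))"
    by (simp add: sum_distrib_left sum_distrib_right)
  also have "\<dots> = (\<Sum>j<N. \<Sum>l<N. if l = j then x j * of_nat N * qcnj (x j) else 0)"
    by (intro sum.cong refl) (simp add: orth)
  also have "\<dots> = (\<Sum>j<N. of_nat N * (x j * qcnj (x j)))"
    by (simp add: mult.assoc mult_of_nat_commute)
  also have "\<dots> = of_real (real N * (\<Sum>j<N. (norm (x j))\<^sup>2))"
    by (simp add: mult_qcnj_self sum_distrib_left)
  finally show ?thesis by (simp only: of_real_eq_iff)
qed

lemma fourier_inversion: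
  assumes "fourier_root N \<omega>" "r < N"
  shows "(\<Sum>j<N. (\<Sum>k<N. a k * \<omega> ^ (j * k)) * qcnj \<omega> ^ (j * r)) = of_nat N * a r"
proof -
  have "(\<Sum>j<N. (\<Sum>k<N. a k * \<omega> ^ (j * k)) * qcnj \<omega> ^ (j * r)) =
      (\<Sum>k<N. a k * (\<Sum>j<N. \<omega> ^ (j * k) * qcnj \<omega> ^ (j * r)))"
    unfolding sum_distrib_right sum_distrib_left by (subst sum.swap) (simp add: mult.assoc)
  also have "\<dots> = (\<Sum>k<N. if k = r then a k * of_nat N else 0)"
    using assms by (intro sum.cong) (auto simp: fourier_root_def)
  also have "\<dots> = of_nat N * a r"
    using assms(2) by (simp add: mult_of_nat_commute)
  finally show ?thesis .
qed

text \<open>Sampling at the \<open>N\<close>-th roots of unity recovers the coefficients of polynomials of degree below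
  \<open>N\<close> exactly, so only the tail of the series from \<open>N\<close> on contributes to the error.\<close>

lemma fourier_sampling_error:
  assumes \<omega>: "fourier_root N \<omega>" and r: "r < N" and a: "summable (\<lambda>k. norm (a k))"
  shows "norm ((\<Sum>j<N. (\<Sum>k. a k * \<omega> ^ (j * k)) * qcnj \<omega> ^ (j * r)) /\<^sub>R real N - a r) \<le> (\<Sum>k. norm (a (k + N)))"
proof -
  have n\<omega>: "norm \<omega> = 1" using \<omega> by (simp add: fourier_root_def)
  have N: "N > 0" using r by simp
  define e where "e = (\<lambda>j. \<Sum>k. a (k + N) * \<omega> ^ (j * (k + N)))"
  have sm: "summable (\<lambda>k. a k * \<omega> ^ (j * k))" for j
    by (rule summable_norm_cancel) (simp add: norm_mult norm_power n\<omega> a)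
  have smN: "summable (\<lambda>k. norm (a (k + N)))" using a by (rule summable_ignore_initial_segment)
  have e: "norm (e j) \<le> (\<Sum>k. norm (a (k + N)))" for j
    unfolding e_def by (rule norm_suminf_le) (simp_all add: norm_mult norm_power n\<omega> smN)
  have "(\<Sum>k. a k * \<omega> ^ (j * k)) = (\<Sum>k<N. a k * \<omega> ^ (j * k)) + e j" for j
    using suminf_split_initial_segment[OF sm, of j N] by (simp add: e_def)
  then have "(\<Sum>j<N. (\<Sum>k. a k * \<omega> ^ (j * k)) * qcnj \<omega> ^ (j * r)) =
      of_nat N * a r + (\<Sum>j<N. e j * qcnj \<omega> ^ (j * r))"
    by (simp add: distrib_right sum.distrib fourier_inversion[OF \<omega> r])
  then have "(\<Sum>j<N. (\<Sum>k. a k * \<omega> ^ (j * k)) * qcnj \<omega> ^ (j * r)) /\<^sub>R real N - a r =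
      (\<Sum>j<N. e j * qcnj \<omega> ^ (j * r)) /\<^sub>R real N"
    using N by (simp add: scaleR_add_right scaleR_conv_of_real[of "real N", symmetric, simplified])
  moreover have "norm (\<Sum>j<N. e j * qcnj \<omega> ^ (j * r)) \<le> (\<Sum>j<N. \<Sum>k. norm (a (k + N)))"
    by (intro sum_norm_le) (simp add: norm_mult norm_power n\<omega> e)
  ultimately show ?thesis
    using N by (simp add: field_simps)
qed

lemma fourier_sampling_tendsto:
  assumes \<omega>: "\<And>N. N > 0 \<Longrightarrow> fourier_root N (\<omega> N)" and a: "summable (\<lambda>k. norm (a k))"
  shows "(\<lambda>N. (\<Sum>j<N. (\<Sum>k. a k * \<omega> N ^ (j * k)) * qcnj (\<omega> N) ^ (j * r)) /\<^sub>R real N) \<longlonglongrightarrow> a r"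
proof (rule Lim_null[THEN iffD2, OF Lim_null_comparison])
  show "(\<lambda>N. \<Sum>k. norm (a (k + N))) \<longlonglongrightarrow> 0"
    using suminf_exist_split2[OF a] .
  show "\<forall>\<^sub>F N in sequentially. norm ((\<Sum>j<N. (\<Sum>k. a k * \<omega> N ^ (j * k)) * qcnj (\<omega> N) ^ (j * r)) /\<^sub>R real N - a r)
      \<le> (\<Sum>k. norm (a (k + N)))"
    using eventually_gt_at_top[of r] by eventually_elim (use fourier_sampling_error[OF \<omega> _ a] in auto)
qed

section \<open>Bounded slice regular functions have contractive Toeplitz matrices\<close>

text \<open>All lower triangular Toeplitz matrices built from \<open>s\<close> are contractions. This is the condition
  on the coefficients to which all four conditions on \<open>S\<close> are reduced.\<close>

definition toeplitz_contractive :: "(nat \<Rightarrow> quat) \<Rightarrow> bool" where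
  "toeplitz_contractive s \<longleftrightarrow>
     (\<forall>n v. (\<Sum>i<n. (norm (\<Sum>j\<le>i. s (i - j) * v j))\<^sup>2) \<le> (\<Sum>j<n. (norm (v j))\<^sup>2))"

lemma has_coeffs_right_summable:
  assumes s: "has_coeffs S s" and p: "norm p < 1"
  shows "summable (\<lambda>m. s m * w * p ^ m)"
  by (rule summable_norm_cancel)
    (use summable_mult2[OF has_coeffs_summable_norm[OF s _ p], of "norm w"] in \<open>simp add: norm_mult norm_power mult_ac\<close>)

text \<open>Writing the powers of the variable on the right of the coefficients does not change the bound.
  For \<open>p = x + y I\<close> the two series are \<open>\<alpha> + I \<beta>\<close> and \<open>\<alpha> + \<beta> I\<close> with \<open>\<alpha>\<close>, \<open>\<beta>\<close> depending on \<open>x\<close> and \<open>y\<close> only.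
  If \<open>\<alpha> = 0\<close>, both have modulus \<open>|\<beta>|\<close>. Otherwise \<open>\<beta> = \<alpha> \<gamma>\<close> for some \<open>\<gamma>\<close>, and
  \<open>|\<alpha> + \<beta> I| = |\<alpha>| |1 + \<gamma> I| = |\<alpha>| |1 + I \<gamma>| = |\<alpha> + J \<beta>|\<close> for the imaginary
  unit \<open>J = \<alpha> I \<alpha>\<^sup>-\<^sup>1\<close>, and the last expression is the modulus of \<open>S\<close> at the point \<open>x + y J\<close>.\<close>

lemma norm_right_series_le_1:
  assumes s: "has_coeffs S s" and S: "\<And>q. norm q < 1 \<Longrightarrow> norm (S q) \<le> 1" and p: "norm p < 1"
  shows "norm (\<Sum>m. s m * p ^ m) \<le> 1"
proof -
  obtain I z where I: "I \<in> imag_units" and pz: "p = slice_emb I z" by (rule slice_embE)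
  have z: "norm z < 1" using p by (simp add: pz norm_slice_emb[OF I])
  define \<alpha> where "\<alpha> = (\<Sum>m. Re (z ^ m) *\<^sub>R s m)"
  define \<beta> where "\<beta> = (\<Sum>m. Im (z ^ m) *\<^sub>R s m)"
  have sm: "summable (\<lambda>m. norm (s m) * norm z ^ m)"
    by (rule has_coeffs_summable_norm[OF s]) (use z in auto)
  have \<alpha>: "(\<lambda>m. Re (z ^ m) *\<^sub>R s m) sums \<alpha>"
    unfolding \<alpha>_def
    by (rule summable_sums, rule summable_comparison_test'[OF sm])
      (use abs_Re_le_cmod in \<open>simp add: mult.commute mult_left_mono flip: norm_power\<close>)
  have \<beta>: "(\<lambda>m. Im (z ^ m) *\<^sub>R s m) sums \<beta>"
    unfolding \<beta>_def
    by (rule summable_sums, rule summable_comparison_test'[OF sm])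
      (use abs_Im_le_cmod in \<open>simp add: mult.commute mult_left_mono flip: norm_power\<close>)
  have left: "S (slice_emb J z) = \<alpha> + J * \<beta>" if J: "J \<in> imag_units" for J
  proof (rule sums_unique2)
    show "(\<lambda>m. slice_emb J z ^ m * s m) sums S (slice_emb J z)"
      using s z by (auto simp: has_coeffs_def norm_slice_emb[OF J])
    have "(\<lambda>m. Re (z ^ m) *\<^sub>R s m + J * (Im (z ^ m) *\<^sub>R s m)) sums (\<alpha> + J * \<beta>)"
      by (intro sums_add sums_mult \<alpha> \<beta>)
    then show "(\<lambda>m. slice_emb J z ^ m * s m) sums (\<alpha> + J * \<beta>)"
      unfolding slice_emb_power[OF J, symmetric] by (simp add: slice_emb_def of_real_def distrib_right)
  qed
  have bound: "norm (\<alpha> + J * \<beta>) \<le> 1" if "J \<in> imag_units" for J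
    using S[of "slice_emb J z"] z that by (simp add: left norm_slice_emb)
  have "(\<lambda>m. Re (z ^ m) *\<^sub>R s m + (Im (z ^ m) *\<^sub>R s m) * I) sums (\<alpha> + \<beta> * I)"
    by (intro sums_add sums_mult2 \<alpha> \<beta>)
  then have "(\<lambda>m. s m * p ^ m) sums (\<alpha> + \<beta> * I)"
    unfolding pz slice_emb_power[OF I, symmetric] by (simp add: slice_emb_def of_real_def distrib_left)
  then have right: "(\<Sum>m. s m * p ^ m) = \<alpha> + \<beta> * I" by (simp add: sums_iff)
  show ?thesis
  proof (cases "\<alpha> = 0")
    case True
    then show ?thesis using bound[OF I] by (simp add: right norm_mult mult.commute)
  next
    case False
    define \<gamma> where "\<gamma> = inverse \<alpha> * \<beta>"
    have \<beta>\<gamma>: "\<beta> = \<alpha> * \<gamma>" using False by (simp add: \<gamma>_def flip: mult.assoc)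
    have "norm (\<alpha> + \<beta> * I) = norm \<alpha> * norm (1 + \<gamma> * I)"
      by (simp add: \<beta>\<gamma> distrib_left mult.assoc flip: norm_mult)
    also have "\<dots> = norm \<alpha> * norm (1 + I * \<gamma>)" by (simp add: norm_one_plus_mult_commute)
    also have "\<dots> = norm (\<alpha> + \<alpha> * I * inverse \<alpha> * \<beta>)"
      by (simp add: \<gamma>_def distrib_left mult.assoc flip: norm_mult)
    also have "\<dots> \<le> 1" by (rule bound[OF imag_units_conjugate[OF I False]])
    finally show ?thesis by (simp add: right)
  qed
qed

text \<open>A factor \<open>w\<close> between the coefficients and the powers can be moved to the far right at the price
  of replacing \<open>p\<close> by its conjugate \<open>w p w\<^sup>-\<^sup>1\<close>, which has the same modulus.\<close>

lemma norm_right_series_twisted_le: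
  assumes s: "has_coeffs S s" and S: "\<And>q. norm q < 1 \<Longrightarrow> norm (S q) \<le> 1" and p: "norm p < 1"
  shows "norm (\<Sum>m. s m * w * p ^ m) \<le> norm w"
proof (cases "w = 0")
  case False
  define q where "q = w * p * inverse w"
  have q: "norm q < 1" using p False unfolding q_def norm_mult norm_inverse by (simp add: field_simps)
  have "q ^ m * w = w * p ^ m" for m
  proof (induction m)
    case (Suc m)
    have "q ^ Suc m * w = q * (w * p ^ m)" using Suc by (simp add: mult.assoc)
    also have "\<dots> = w * p * (inverse w * w) * p ^ m" unfolding q_def by (simp only: mult.assoc)
    finally show ?case using False by (simp add: mult.assoc)
  qed simp
  then have "(\<Sum>m. s m * w * p ^ m) = (\<Sum>m. s m * q ^ m * w)" by (simp add: mult.assoc)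
  also have "\<dots> = (\<Sum>m. s m * q ^ m) * w"
    using has_coeffs_right_summable[OF s q, of 1] by (intro suminf_mult2[symmetric]) simp
  finally show ?thesis
    using mult_right_mono[OF norm_right_series_le_1[OF s S q], of "norm w"] by (simp add: norm_mult)
qed simp

text \<open>With the variable on the right, the convolution of \<open>s\<close> and \<open>v\<close> has the generating function of
  the preceding lemma, where \<open>w\<close> is the value at \<open>p\<close> of the generating function of \<open>v\<close>.\<close>

lemma convolution_right_series:
  assumes s: "has_coeffs S s" and p: "norm p < 1" and v: "\<And>j. j \<ge> n \<Longrightarrow> v j = 0"
  shows "(\<lambda>k. (\<Sum>j\<le>k. s (k - j) * v j) * p ^ k) sums (\<Sum>m. s m * (\<Sum>j<n. v j * p ^ j) * p ^ m)"
proof -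
  have shift: "(\<lambda>k. if j \<le> k then s (k - j) * v j * p ^ k else 0) sums (\<Sum>m. s m * (v j * p ^ j) * p ^ m)" for j
  proof -
    have "(\<lambda>m. s m * (v j * p ^ j) * p ^ m) sums (\<Sum>m. s m * (v j * p ^ j) * p ^ m)"
      by (rule summable_sums[OF has_coeffs_right_summable[OF s p]])
    moreover have "s m * (v j * p ^ j) * p ^ m = s (m + j - j) * v j * p ^ (m + j)" for m
      by (simp add: mult.assoc power_add power_commutes flip: power_add) (simp add: add.commute)
    ultimately show ?thesis
      by (subst sums_zero_iff_shift[of j, symmetric]) auto
  qed
  have "(\<lambda>k. \<Sum>j<n. if j \<le> k then s (k - j) * v j * p ^ k else 0) sums
      (\<Sum>j<n. \<Sum>m. s m * (v j * p ^ j) * p ^ m)"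
    by (rule sums_sum) (rule shift)
  moreover have "(\<Sum>j<n. if j \<le> k then s (k - j) * v j * p ^ k else 0) = (\<Sum>j\<le>k. s (k - j) * v j) * p ^ k" for k
    unfolding sum_distrib_right
    by (rule sum.mono_neutral_cong) (use v in auto)
  moreover have "(\<Sum>j<n. \<Sum>m. s m * (v j * p ^ j) * p ^ m) = (\<Sum>m. s m * (\<Sum>j<n. v j * p ^ j) * p ^ m)"
    by (subst suminf_sum[symmetric])
      (simp_all add: has_coeffs_right_summable[OF s p] sum_distrib_left sum_distrib_right)
  ultimately show ?thesis by simp
qed

text \<open>On the circle of radius \<open>\<rho>\<close> in a slice, the generating function of the convolution is
  bounded pointwise by that of \<open>v\<close>. Discrete Parseval for \<open>N\<close> sample points turns this into an
  inequality between sums of squares of sampled coefficients, which tend to the true ones as \<open>N\<close>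
  grows.\<close>

lemma bounded_imp_toeplitz_contractive_aux:
  assumes s: "has_coeffs S s" and S: "\<And>q. norm q < 1 \<Longrightarrow> norm (S q) \<le> 1"
    and v: "\<And>j. j \<ge> n \<Longrightarrow> v j = 0" and \<rho>: "0 < \<rho>" "\<rho> < 1"
  shows "(\<Sum>k<n. (norm (\<Sum>j\<le>k. s (k - j) * v j) * \<rho> ^ k)\<^sup>2) \<le> (\<Sum>k<n. (norm (v k))\<^sup>2)"
proof -
  define h where "h = (\<lambda>k. \<Sum>j\<le>k. s (k - j) * v j)"
  define b where "b = (\<lambda>k. \<rho> ^ k *\<^sub>R h k)"
  define c where "c = (\<lambda>k. \<rho> ^ k *\<^sub>R v k)"
  obtain \<omega> where \<omega>: "\<And>N. N > 0 \<Longrightarrow> fourier_root N (\<omega> N)"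
    using fourier_root_exists by metis
  have n\<omega>: "norm (\<omega> N) = 1" if "N > 0" for N using \<omega>[OF that] by (simp add: fourier_root_def)
  have hs: "(\<lambda>k. h k * p ^ k) sums (\<Sum>m. s m * (\<Sum>j<n. v j * p ^ j) * p ^ m)" if "norm p < 1" for p
    unfolding h_def by (rule convolution_right_series[OF s that v])
  have b_summable: "summable (\<lambda>k. norm (b k))"
  proof -
    obtain \<sigma> where \<sigma>: "\<rho> < \<sigma>" "\<sigma> < 1" using \<rho> dense by blast
    then have "summable (\<lambda>k. h k * of_real \<sigma> ^ k)"
      using hs[of "of_real \<sigma>"] \<rho> by (auto simp: sums_iff)
    from powser_insidea[OF this, of "of_real \<rho>"] show ?thesis
      using \<sigma> \<rho> by (simp add: b_def norm_mult norm_power mult.commute)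
  qed
  \<comment> \<open>\<open>x N\<close> samples the generating function of the convolution, and \<open>X N\<close> is its discrete Fourier transform.\<close>
  define x where "x = (\<lambda>N j. \<Sum>k. b k * \<omega> N ^ (j * k))"
  define X where "X = (\<lambda>N r. (\<Sum>j<N. x N j * qcnj (\<omega> N) ^ (j * r)) /\<^sub>R real N)"
  have X: "(\<Sum>r<n. (norm (X N r))\<^sup>2) \<le> (\<Sum>r<n. (norm (v r))\<^sup>2)" if N: "N > 0" "n \<le> N" for N
  proof -
    define y where "y = (\<lambda>j. \<Sum>k<N. c k * \<omega> N ^ (j * k))"
    have xy: "norm (x N j) \<le> norm (y j)" for j
    proof -
      define p where "p = \<rho> *\<^sub>R \<omega> N ^ j"
      have p: "norm p < 1" using \<rho> n\<omega>[OF N(1)] by (simp add: p_def norm_power)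
      have pk: "p ^ k = \<rho> ^ k *\<^sub>R \<omega> N ^ (j * k)" for k
        by (simp add: p_def scaleR_power power_mult)
      have "x N j = (\<Sum>m. s m * (\<Sum>j<n. v j * p ^ j) * p ^ m)"
        using hs[OF p] by (simp add: x_def b_def pk sums_iff)
      moreover have "y j = (\<Sum>j<n. v j * p ^ j)"
        unfolding y_def by (rule sum.mono_neutral_cong_right) (use N v in \<open>auto simp: c_def pk\<close>)
      ultimately show ?thesis
        using norm_right_series_twisted_le[OF s S p] by simp
    qed
    have "(\<Sum>r<n. (norm (X N r))\<^sup>2) \<le> (\<Sum>r<N. (norm (X N r))\<^sup>2)"
      using N by (intro sum_mono2) auto
    also have "\<dots> = (\<Sum>r<N. (norm (\<Sum>j<N. x N j * qcnj (\<omega> N) ^ (j * r)))\<^sup>2) / (real N)\<^sup>2"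
      by (simp add: X_def power_divide sum_divide_distrib divide_inverse_commute power_mult_distrib sum_distrib_left
          flip: power_inverse)
    also have "\<dots> \<le> (\<Sum>r<N. (norm (\<Sum>j<N. y j * qcnj (\<omega> N) ^ (j * r)))\<^sup>2) / (real N)\<^sup>2"
      unfolding fourier_parseval[OF \<omega>[OF N(1)]]
      by (intro divide_right_mono mult_left_mono sum_mono power_mono xy) auto
    also have "\<dots> = (\<Sum>r<N. (norm (of_nat N * c r))\<^sup>2) / (real N)\<^sup>2"
      unfolding y_def using fourier_inversion[OF \<omega>[OF N(1)]] by simp
    also have "\<dots> = (\<Sum>r<N. (norm (c r))\<^sup>2)"
      using N by (simp add: norm_mult power_mult_distrib flip: sum_distrib_left)
    also have "\<dots> \<le> (\<Sum>r<N. (norm (v r))\<^sup>2)"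
    proof (intro sum_mono power_mono)
      show "norm (c r) \<le> norm (v r)" for r
        using \<rho> mult_right_mono[of "\<rho> ^ r" 1 "norm (v r)"] by (simp add: c_def power_le_one)
    qed simp
    also have "\<dots> = (\<Sum>r<n. (norm (v r))\<^sup>2)"
      by (rule sum.mono_neutral_right) (use N v in auto)
    finally show ?thesis .
  qed
  have "(\<lambda>N. X N r) \<longlonglongrightarrow> b r" for r
    unfolding X_def x_def by (rule fourier_sampling_tendsto[OF \<omega> b_summable])
  then have "(\<lambda>N. \<Sum>r<n. (norm (X N r))\<^sup>2) \<longlonglongrightarrow> (\<Sum>r<n. (norm (b r))\<^sup>2)"
    by (intro tendsto_intros)
  then have "(\<Sum>r<n. (norm (b r))\<^sup>2) \<le> (\<Sum>r<n. (norm (v r))\<^sup>2)"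
    by (rule tendsto_upperbound)
      (use X in \<open>auto intro!: eventually_mono[OF eventually_gt_at_top[of n]]\<close>)
  then show ?thesis
    using \<rho> by (simp add: b_def h_def mult.commute)
qed

text \<open>Let \<open>\<rho>\<close> tend to \<open>1\<close> in the preceding lemma, applied to the truncation of \<open>v\<close>.\<close>

theorem bounded_imp_toeplitz_contractive:
  assumes s: "has_coeffs S s" and S: "\<And>q. norm q < 1 \<Longrightarrow> norm (S q) \<le> 1"
  shows "toeplitz_contractive s"
  unfolding toeplitz_contractive_def
proof (intro allI)
  fix n and v :: "nat \<Rightarrow> quat"
  define u where "u = (\<lambda>j. if j < n then v j else 0)"
  have "(\<Sum>k<n. (norm (\<Sum>j\<le>k. s (k - j) * u j) * \<rho> ^ k)\<^sup>2) \<le> (\<Sum>k<n. (norm (u k))\<^sup>2)"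
    if "0 < \<rho>" "\<rho> < 1" for \<rho> :: real
    by (rule bounded_imp_toeplitz_contractive_aux[OF s S _ that]) (auto simp: u_def)
  then have ev: "\<forall>\<^sub>F \<rho> in at_left (1::real). (\<Sum>k<n. (norm (\<Sum>j\<le>k. s (k - j) * u j) * \<rho> ^ k)\<^sup>2) \<le> (\<Sum>k<n. (norm (u k))\<^sup>2)"
    unfolding eventually_at_left_field by (intro exI[of _ 0]) auto
  have "((\<lambda>\<rho>. \<Sum>k<n. (norm (\<Sum>j\<le>k. s (k - j) * u j) * \<rho> ^ k)\<^sup>2) \<longlongrightarrow>
      (\<Sum>k<n. (norm (\<Sum>j\<le>k. s (k - j) * u j) * 1 ^ k)\<^sup>2)) (at_left 1)"
    by (intro tendsto_intros)
  from tendsto_upperbound[OF this ev]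
  have "(\<Sum>k<n. (norm (\<Sum>j\<le>k. s (k - j) * u j))\<^sup>2) \<le> (\<Sum>k<n. (norm (u k))\<^sup>2)" by simp
  moreover have "(\<Sum>j\<le>k. s (k - j) * u j) = (\<Sum>j\<le>k. s (k - j) * v j)" if "k < n" for k
    using that by (intro sum.cong) (auto simp: u_def)
  ultimately show "(\<Sum>k<n. (norm (\<Sum>j\<le>k. s (k - j) * v j))\<^sup>2) \<le> (\<Sum>j<n. (norm (v j))\<^sup>2)"
    by (simp add: u_def)
qed

section \<open>Toeplitz matrices and the star product\<close>

lemma toeplitz_row:
  fixes s v :: "nat \<Rightarrow> quat"
  assumes "i < n"
  shows "(\<Sum>j<n. (if j \<le> i then s (i - j) else 0) * v j) = (\<Sum>j\<le>i. s (i - j) * v j)"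
  by (rule sum.mono_neutral_cong_right) (use assms in auto)

lemma toeplitz_contractive_iff_adjoint:
  "toeplitz_contractive s \<longleftrightarrow>
    (\<forall>n c. (\<Sum>j<n. (norm (\<Sum>i<n. qcnj (if j \<le> i then s (i - j) else 0) * c i))\<^sup>2) \<le> (\<Sum>i<n. (norm (c i))\<^sup>2))"
proof -
  define B where "B = (\<lambda>i j. if j \<le> i then s (i - j) else 0)"
  have "(\<forall>v. (\<Sum>i<n. (norm (\<Sum>j<n. B i j * v j))\<^sup>2) \<le> (\<Sum>j<n. (norm (v j))\<^sup>2)) \<longleftrightarrow>
      (\<forall>c. (\<Sum>j<n. (norm (\<Sum>i<n. qcnj (B i j) * c i))\<^sup>2) \<le> (\<Sum>i<n. (norm (c i))\<^sup>2))" for n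
    using matrix_contraction_adjoint[where B = B and n = n]
      matrix_contraction_adjoint[where B = "\<lambda>j i. qcnj (B i j)" and n = n, simplified]
    by blast
  then show ?thesis
    by (simp add: toeplitz_contractive_def B_def toeplitz_row)
qed

theorem toeplitz_contractive_iff_psd:
  "toeplitz_contractive s \<longleftrightarrow>
    (\<forall>n. qpos_semidef (1\<^sub>m (n + 1) - lower_toeplitz s n * qadjoint (lower_toeplitz s n)))"
proof -
  define P where "P = (\<lambda>n. \<forall>c. (\<Sum>j<n. (norm (\<Sum>i<n. qcnj (if j \<le> i then s (i - j) else 0) * c i))\<^sup>2) \<le>
    (\<Sum>i<n. (norm (c i :: quat))\<^sup>2))"
  have "qpos_semidef (1\<^sub>m (n + 1) - lower_toeplitz s n * qadjoint (lower_toeplitz s n)) \<longleftrightarrow> P (n + 1)" for n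
  proof -
    have "lower_toeplitz s n \<in> carrier_mat (n + 1) (n + 1)" by (simp add: lower_toeplitz_def)
    moreover have "(\<Sum>i<n + 1. qcnj (lower_toeplitz s n $$ (i, j)) * c i) =
        (\<Sum>i<n + 1. qcnj (if j \<le> i then s (i - j) else 0) * c i)" if "j < n + 1" for j c
      using that by (intro sum.cong) (auto simp: lower_toeplitz_def)
    ultimately show ?thesis
      by (simp add: qpos_semidef_diff_mult_adjoint_iff P_def del: sum.lessThan_Suc cong: sum.cong_simp)
  qed
  moreover have "P 0" by (simp add: P_def)
  moreover have "(\<forall>n. P n) \<longleftrightarrow> P 0 \<and> (\<forall>n. P (n + 1))"
    by (metis Suc_eq_plus1 not0_implies_Suc)
  ultimately show ?thesis
    by (simp add: toeplitz_contractive_iff_adjoint flip: P_def)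
qed

lemma sum_triangle_rows:
  fixes g :: "nat \<Rightarrow> nat \<Rightarrow> 'a::comm_monoid_add"
  shows "(\<Sum>n<N. \<Sum>j\<le>n. g j (n - j)) = (\<Sum>j<N. \<Sum>m<N - j. g j m)"
proof -
  have "{(j, m). j + m < N} = Sigma {..<N} (\<lambda>j. {..<N - j})" by auto
  then show ?thesis
    by (simp add: sum.Sigma flip: sum.triangle_reindex)
qed

text \<open>Since \<open>p\<close> commutes with its own powers, \<open>p\<^sup>j S(p) a\<^sub>j = (\<Sum>m. p\<^sup>j (p\<^sup>m s\<^sub>m) a\<^sub>j)\<close>. Summing over \<open>j\<close> by
  rows gives \<open>star_prod\<close>, and by antidiagonals the convolution. The partial sums of the two
  differ by at most the same difference for the product of the two real series of norms, and that
  tends to \<open>0\<close> by Cauchy's theorem on products of absolutely convergent series.\<close>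

theorem has_coeffs_star_prod:
  assumes s: "has_coeffs S s" and a: "has_coeffs f a"
  shows "has_coeffs (star_prod S f) (\<lambda>k. \<Sum>j\<le>k. s (k - j) * a j)"
  unfolding has_coeffs_def
proof
  fix p assume p: "p \<in> \<bool>"
  define A where "A = (\<lambda>k. norm (p ^ k * a k))"
  define B where "B = (\<lambda>m. norm (p ^ m * s m))"
  have A: "summable A" and B: "summable B"
    using has_coeffs_summable_norm[OF a, of "norm p"] has_coeffs_summable_norm[OF s, of "norm p"] p
    by (simp_all add: A_def B_def norm_mult norm_power mult.commute)
  have pos: "A k \<ge> 0" "B k \<ge> 0" for k by (simp_all add: A_def B_def)
  have Sp: "(\<lambda>m. p ^ m * s m) sums S p" using s p by (simp add: has_coeffs_def)
  define U where "U = (\<lambda>N. \<Sum>k<N. p ^ k * S p * a k)"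
  define T where "T = (\<lambda>N. \<Sum>n<N. p ^ n * (\<Sum>j\<le>n. s (n - j) * a j))"
  have normA: "norm (p ^ k * x * a k) = A k * norm x" for k x
    by (simp add: A_def norm_mult)
  have "U \<longlonglongrightarrow> star_prod S f p"
  proof -
    have "summable (\<lambda>k. p ^ k * S p * a k)"
      by (rule summable_norm_cancel) (unfold normA, rule summable_mult2[OF A])
    then show ?thesis
      unfolding U_def star_prod_def coeffs_of_eq[OF a] by (rule summable_LIMSEQ)
  qed
  moreover have "(\<lambda>N. U N - T N) \<longlonglongrightarrow> 0"
  proof (rule Lim_null_comparison)
    \<comment> \<open>the difference of the partial sums for the series of norms\<close>
    define R where "R = (\<lambda>N. (\<Sum>k<N. A k) * suminf B - (\<Sum>n<N. \<Sum>j\<le>n. A j * B (n - j)))"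
    have "(\<lambda>N. \<Sum>n<N. \<Sum>j\<le>n. A j * B (n - j)) \<longlonglongrightarrow> suminf A * suminf B"
      using Cauchy_product_sums[of A B] A B pos unfolding sums_def by simp
    then have "R \<longlonglongrightarrow> suminf A * suminf B - suminf A * suminf B"
      unfolding R_def using summable_LIMSEQ[OF A] by (intro tendsto_diff tendsto_mult_right)
    then show "R \<longlonglongrightarrow> 0" by simp
    have "norm (U N - T N) \<le> R N" for N
    proof -
      have "p ^ n * (s (n - j) * a j) = p ^ j * (p ^ (n - j) * s (n - j)) * a j" if "j \<le> n" for n j
        using that by (simp add: mult.assoc[symmetric] flip: power_add)
      then have "T N = (\<Sum>n<N. \<Sum>j\<le>n. p ^ j * (p ^ (n - j) * s (n - j)) * a j)"
        unfolding T_def sum_distrib_left by (intro sum.cong) auto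
      also have "\<dots> = (\<Sum>j<N. \<Sum>m<N - j. p ^ j * (p ^ m * s m) * a j)"
        by (rule sum_triangle_rows[where g = "\<lambda>j m. p ^ j * (p ^ m * s m) * a j"])
      finally have "U N - T N = (\<Sum>j<N. p ^ j * (S p - (\<Sum>m<N - j. p ^ m * s m)) * a j)"
        by (simp add: U_def right_diff_distrib left_diff_distrib sum_subtractf sum_distrib_left sum_distrib_right)
      also have "norm \<dots> \<le> (\<Sum>j<N. A j * (suminf B - (\<Sum>m<N - j. B m)))"
      proof (rule sum_norm_le)
        fix j
        define n where "n = N - j"
        have "S p - (\<Sum>m<n. p ^ m * s m) = (\<Sum>m. p ^ (m + n) * s (m + n))"
          using suminf_minus_initial_segment[of "\<lambda>m. p ^ m * s m" n] Sp by (simp add: sums_iff)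
        also have "norm \<dots> \<le> (\<Sum>m. B (m + n))"
          by (rule norm_suminf_le) (use summable_ignore_initial_segment[OF B] in \<open>simp_all add: B_def\<close>)
        also have "\<dots> = suminf B - (\<Sum>m<n. B m)"
          using B by (rule suminf_minus_initial_segment)
        finally show "norm (p ^ j * (S p - (\<Sum>m<N - j. p ^ m * s m)) * a j) \<le> A j * (suminf B - (\<Sum>m<N - j. B m))"
          unfolding normA n_def by (rule mult_left_mono) (rule pos)
      qed
      also have "\<dots> = R N"
        unfolding R_def sum_triangle_rows[of "\<lambda>j m. A j * B m"]
        by (simp add: right_diff_distrib sum_subtractf sum_distrib_left sum_distrib_right)
      finally show ?thesis .
    qed
    then show "\<forall>\<^sub>F N in sequentially. norm (U N - T N) \<le> R N" by simp
  qed
  ultimately have "(\<lambda>N. U N - (U N - T N)) \<longlonglongrightarrow> star_prod S f p - 0"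
    by (rule tendsto_diff)
  then have "T \<longlonglongrightarrow> star_prod S f p" by simp
  then show "(\<lambda>k. p ^ k * (\<Sum>j\<le>k. s (k - j) * a j)) sums star_prod S f p"
    by (simp add: sums_def T_def)
qed

lemma hardy_space_iff: "has_coeffs f a \<Longrightarrow> f \<in> H\<^sup>2 \<longleftrightarrow> summable (\<lambda>k. (norm (a k))\<^sup>2)"
  unfolding hardy_space_def by (auto dest: coeffs_of_eq)

lemma hardy_norm_eq: "has_coeffs f a \<Longrightarrow> hardy_norm f = sqrt (\<Sum>k. (norm (a k))\<^sup>2)"
  by (simp add: hardy_norm_def coeffs_of_eq)

lemma has_coeffs_polynomial:
  assumes "\<And>k. k \<ge> n \<Longrightarrow> a k = 0"
  shows "has_coeffs (\<lambda>p. \<Sum>k<n. p ^ k * a k) a"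
  unfolding has_coeffs_def
  by (intro ballI sums_finite) (use assms in \<open>auto simp: not_less\<close>)

theorem toeplitz_contractive_imp_hardy_contraction:
  assumes s: "has_coeffs S s" and tc: "toeplitz_contractive s"
  shows "hardy_contraction (star_prod S)"
  unfolding hardy_contraction_def
proof
  fix f assume "f \<in> H\<^sup>2"
  then obtain a where a: "has_coeffs f a" and sa: "summable (\<lambda>k. (norm (a k))\<^sup>2)"
    by (auto simp: hardy_space_def)
  define h where "h = (\<lambda>k. \<Sum>j\<le>k. s (k - j) * a j)"
  have h: "has_coeffs (star_prod S f) h"
    unfolding h_def by (rule has_coeffs_star_prod[OF s a])
  have le: "(\<Sum>k<n. (norm (h k))\<^sup>2) \<le> (\<Sum>k. (norm (a k))\<^sup>2)" for n
  proof -
    have "(\<Sum>k<n. (norm (h k))\<^sup>2) \<le> (\<Sum>k<n. (norm (a k))\<^sup>2)"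
      using tc by (simp add: toeplitz_contractive_def h_def)
    also have "\<dots> \<le> (\<Sum>k. (norm (a k))\<^sup>2)"
      using sa by (intro sum_le_suminf) auto
    finally show ?thesis .
  qed
  have sh: "summable (\<lambda>k. (norm (h k))\<^sup>2)"
  proof (rule bounded_imp_summable)
    show "(\<Sum>k\<le>n. (norm (h k))\<^sup>2) \<le> (\<Sum>k. (norm (a k))\<^sup>2)" for n
      using le[of "Suc n"] by (simp only: lessThan_Suc_atMost)
  qed simp
  show "star_prod S f \<in> H\<^sup>2 \<and> hardy_norm (star_prod S f) \<le> hardy_norm f"
    using sh suminf_le_const[OF sh le]
    by (simp add: hardy_space_iff[OF h] hardy_norm_eq[OF h] hardy_norm_eq[OF a])
qed

text \<open>Applying the operator to the constant \<open>1\<close> returns \<open>S\<close> itself, so \<open>S\<close> has a power series; applying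
  it to polynomials and truncating the result bounds the Toeplitz matrices.\<close>

theorem hardy_contraction_imp_toeplitz_contractive:
  assumes hc: "hardy_contraction (star_prod S)"
  shows "\<exists>s. has_coeffs S s \<and> toeplitz_contractive s"
proof -
  define e where "e = (\<lambda>k::nat. if k = 0 then 1 else 0 :: quat)"
  define one where "one = (\<lambda>p :: quat. \<Sum>k<1::nat. p ^ k * e k)"
  have e: "has_coeffs one e"
    unfolding one_def by (rule has_coeffs_polynomial) (simp add: e_def)
  have "summable (\<lambda>k. (norm (e k))\<^sup>2)"
    by (rule summable_finite[of "{0}"]) (auto simp: e_def)
  then have "one \<in> H\<^sup>2" by (simp add: hardy_space_iff[OF e])
  then have "star_prod S one \<in> H\<^sup>2" using hc by (simp add: hardy_contraction_def)
  moreover have "star_prod S one = S"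
  proof
    fix p
    have "star_prod S one p = (\<Sum>k\<in>{0}. p ^ k * S p * e k)"
      unfolding star_prod_def coeffs_of_eq[OF e] by (rule suminf_finite) (auto simp: e_def)
    then show "star_prod S one p = S p" by (simp add: e_def)
  qed
  ultimately obtain s where s: "has_coeffs S s"
    by (auto simp: hardy_space_def)
  have "toeplitz_contractive s"
    unfolding toeplitz_contractive_def
  proof (intro allI)
    fix n and v :: "nat \<Rightarrow> quat"
    define a where "a = (\<lambda>k. if k < n then v k else 0)"
    define f where "f = (\<lambda>p. \<Sum>k<n. p ^ k * a k)"
    define h where "h = (\<lambda>k. \<Sum>j\<le>k. s (k - j) * a j)"
    have a: "has_coeffs f a"
      unfolding f_def by (rule has_coeffs_polynomial) (simp add: a_def)
    have h: "has_coeffs (star_prod S f) h"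
      unfolding h_def by (rule has_coeffs_star_prod[OF s a])
    have as: "(\<lambda>k. (norm (a k))\<^sup>2) sums (\<Sum>k<n. (norm (a k))\<^sup>2)"
      by (rule sums_finite) (auto simp: a_def)
    then have "f \<in> H\<^sup>2"
      unfolding hardy_space_iff[OF a] by (rule sums_summable)
    then have "star_prod S f \<in> H\<^sup>2" "hardy_norm (star_prod S f) \<le> hardy_norm f"
      using hc unfolding hardy_contraction_def by blast+
    then have sh: "summable (\<lambda>k. (norm (h k))\<^sup>2)"
      and "(\<Sum>k. (norm (h k))\<^sup>2) \<le> (\<Sum>k. (norm (a k))\<^sup>2)"
      unfolding hardy_space_iff[OF h] hardy_norm_eq[OF h] hardy_norm_eq[OF a] real_sqrt_le_iff .
    moreover have "(\<Sum>k<n. (norm (h k))\<^sup>2) \<le> (\<Sum>k. (norm (h k))\<^sup>2)"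
      by (rule sum_le_suminf[OF sh]) auto
    ultimately have "(\<Sum>k<n. (norm (h k))\<^sup>2) \<le> (\<Sum>k<n. (norm (a k))\<^sup>2)"
      unfolding sums_unique[OF as] by linarith
    moreover have "h k = (\<Sum>j\<le>k. s (k - j) * v j)" if "k < n" for k
      unfolding h_def using that by (intro sum.cong) (auto simp: a_def)
    ultimately show "(\<Sum>i<n. (norm (\<Sum>j\<le>i. s (i - j) * v j))\<^sup>2) \<le> (\<Sum>j<n. (norm (v j))\<^sup>2)"
      by (simp add: a_def)
  qed
  with s show ?thesis by blast
qed

section \<open>The kernel as a quadratic form\<close>

text \<open>The function \<open>p \<mapsto> (\<Sum>k. p ^ k * qcnj q ^ k)\<close> is the reproducing kernel of the Hardy space at \<open>q\<close>. With \<open>b = 1\<close> the sequence below is the coefficient sequence of the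
  combination \<open>g\<close> of the kernels at the points \<open>q i\<close> with weights \<open>c i\<close>. With \<open>b i\<close> the conjugate of
  \<open>S (q i)\<close> it is the sequence to which the adjoint of star multiplication by \<open>S\<close> sends \<open>g\<close>, whenever
  that multiplication is a bounded operator.\<close>

definition kernel_seq :: "nat \<Rightarrow> (nat \<Rightarrow> quat) \<Rightarrow> (nat \<Rightarrow> quat) \<Rightarrow> (nat \<Rightarrow> quat) \<Rightarrow> nat \<Rightarrow> quat" where
  "kernel_seq r b q c k = (\<Sum>i<r. b i * qcnj (q i) ^ k * c i)"

lemma kernel_seq_summable_sq:
  assumes q: "\<And>i. i < r \<Longrightarrow> norm (q i) < 1"
  shows "summable (\<lambda>k. (norm (kernel_seq r b q c k))\<^sup>2)"
proof -
  have "summable (\<lambda>k. \<Sum>i<r. norm (b i) * norm (q i) ^ k * norm (c i))"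
    by (intro summable_sum summable_mult summable_mult2 summable_geometric) (use q in simp)
  then have sm: "summable (\<lambda>k. norm (kernel_seq r b q c k))"
    by (rule summable_comparison_test'[where N = 0])
      (auto simp: kernel_seq_def norm_mult norm_power intro!: sum_norm_le)
  then have "(\<lambda>k. norm (kernel_seq r b q c k)) \<longlonglongrightarrow> 0" by (rule summable_LIMSEQ_zero)
  then have "\<forall>\<^sub>F k in sequentially. norm (kernel_seq r b q c k) < 1"
    by (rule order_tendstoD) simp
  then have "\<forall>\<^sub>F k in sequentially. norm ((norm (kernel_seq r b q c k))\<^sup>2) \<le> norm (kernel_seq r b q c k)"
    by eventually_elim (simp add: power2_eq_square mult_left_le)
  then show ?thesis
    by (rule summable_comparison_test_ev) (rule sm)
qed

lemma schur_kernel_sums: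
  assumes "norm p < 1" "norm q < 1"
  shows "(\<lambda>k. p ^ k * (1 - S p * qcnj (S q)) * qcnj q ^ k) sums schur_kernel S p q"
  unfolding schur_kernel_def
proof (rule summable_sums, rule summable_norm_cancel)
  have "norm p * norm q < 1" using assms mult_strict_mono[of "norm p" 1 "norm q" 1] by simp
  then have "summable (\<lambda>k. norm (1 - S p * qcnj (S q)) * (norm p * norm q) ^ k)"
    by (intro summable_mult summable_geometric) simp
  then show "summable (\<lambda>k. norm (p ^ k * (1 - S p * qcnj (S q)) * qcnj q ^ k))"
    by (simp add: norm_mult norm_power power_mult_distrib mult_ac)
qed

lemma schur_kernel_hermitian:
  assumes "norm p < 1" "norm q < 1"
  shows "qcnj (schur_kernel S p q) = schur_kernel S q p"
proof (rule sums_unique2)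
  show "(\<lambda>k. q ^ k * (1 - S q * qcnj (S p)) * qcnj p ^ k) sums schur_kernel S q p"
    using assms by (intro schur_kernel_sums)
  show "(\<lambda>k. q ^ k * (1 - S q * qcnj (S p)) * qcnj p ^ k) sums qcnj (schur_kernel S p q)"
    using bounded_linear.sums[OF bounded_linear_qcnj schur_kernel_sums[OF assms, of S]]
    by (simp add: qcnj_mult qcnj_power qcnj_diff mult.assoc)
qed

lemma schur_kernel_quadratic_form:
  assumes q: "\<And>i. i < r \<Longrightarrow> norm (q i) < 1"
  shows "(\<Sum>i<r. \<Sum>j<r. qcnj (c i) * schur_kernel S (q i) (q j) * c j) =
    of_real ((\<Sum>k. (norm (kernel_seq r (\<lambda>_. 1) q c k))\<^sup>2) - (\<Sum>k. (norm (kernel_seq r (\<lambda>i. qcnj (S (q i))) q c k))\<^sup>2))"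
proof (rule sums_unique2)
  define g where "g = kernel_seq r (\<lambda>_. 1) q c"
  define t where "t = kernel_seq r (\<lambda>i. qcnj (S (q i))) q c"
  have "(\<lambda>k. \<Sum>i<r. \<Sum>j<r. qcnj (c i) * (q i ^ k * (1 - S (q i) * qcnj (S (q j))) * qcnj (q j) ^ k) * c j) sums
      (\<Sum>i<r. \<Sum>j<r. qcnj (c i) * schur_kernel S (q i) (q j) * c j)"
    by (intro sums_sum sums_mult sums_mult2 schur_kernel_sums) (use q in auto)
  moreover have "(\<Sum>i<r. \<Sum>j<r. qcnj (c i) * (q i ^ k * (1 - S (q i) * qcnj (S (q j))) * qcnj (q j) ^ k) * c j) =
      of_real ((norm (g k))\<^sup>2 - (norm (t k))\<^sup>2)" for k
  proof -
    have "(\<Sum>i<r. \<Sum>j<r. qcnj (c i) * (q i ^ k * (1 - S (q i) * qcnj (S (q j))) * qcnj (q j) ^ k) * c j) =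
        qcnj (g k) * g k - qcnj (t k) * t k"
      by (simp add: g_def t_def kernel_seq_def qcnj_sum qcnj_mult qcnj_power sum_product
          right_diff_distrib left_diff_distrib sum_subtractf mult.assoc)
    then show ?thesis by (simp add: qcnj_mult_self)
  qed
  ultimately show "(\<lambda>k. of_real ((norm (g k))\<^sup>2 - (norm (t k))\<^sup>2)) sums
      (\<Sum>i<r. \<Sum>j<r. qcnj (c i) * schur_kernel S (q i) (q j) * c j)"
    by simp
  show "(\<lambda>k. of_real ((norm (g k))\<^sup>2 - (norm (t k))\<^sup>2) :: quat) sums
      of_real ((\<Sum>k. (norm (kernel_seq r (\<lambda>_. 1) q c k))\<^sup>2) - (\<Sum>k. (norm (kernel_seq r (\<lambda>i. qcnj (S (q i))) q c k))\<^sup>2))"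
    unfolding g_def t_def
    by (intro sums_of_real sums_diff summable_sums kernel_seq_summable_sq q)
qed

text \<open>Positivity of the kernel says that the would-be adjoint of star multiplication by \<open>S\<close>, defined on
  the span of the reproducing kernels, is a contraction there.\<close>

theorem positive_schur_kernel_iff:
  "positive_kernel \<bool> (schur_kernel S) \<longleftrightarrow>
    (\<forall>r q c. (\<forall>i<r. norm (q i) < 1) \<longrightarrow>
      (\<Sum>k. (norm (kernel_seq r (\<lambda>i. qcnj (S (q i))) q c k))\<^sup>2) \<le> (\<Sum>k. (norm (kernel_seq r (\<lambda>_. 1) q c k))\<^sup>2))"
proof -
  have "qpos_semidef (Matrix.mat r r (\<lambda>(i, j). schur_kernel S (q i) (q j))) \<longleftrightarrow>
      (\<forall>c. (\<Sum>k. (norm (kernel_seq r (\<lambda>i. qcnj (S (q i))) q c k))\<^sup>2) \<le> (\<Sum>k. (norm (kernel_seq r (\<lambda>_. 1) q c k))\<^sup>2))"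
    (is "qpos_semidef ?A \<longleftrightarrow> (\<forall>c. ?t c \<le> ?g c)")
    if q: "\<And>i. i < r \<Longrightarrow> norm (q i) < 1" for r q
  proof -
    have "qadjoint ?A = ?A"
      by (intro eq_matI) (auto simp: qadjoint_def schur_kernel_hermitian q)
    moreover have "scalar_prod (map_vec qcnj v) (?A *\<^sub>v v) = of_real (?g (vec_index v) - ?t (vec_index v))"
      if v: "v \<in> carrier_vec r" for v
    proof -
      have "scalar_prod (map_vec qcnj v) (?A *\<^sub>v v) =
          (\<Sum>i<r. \<Sum>j<r. qcnj (vec_index v i) * schur_kernel S (q i) (q j) * vec_index v j)"
        using v by (simp add: scalar_prod_def lessThan_atLeast0 sum_distrib_left mult.assoc)
      then show ?thesis by (simp only: schur_kernel_quadratic_form[OF q])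
    qed
    ultimately have "qpos_semidef ?A \<longleftrightarrow> (\<forall>v\<in>carrier_vec r. ?t (vec_index v) \<le> ?g (vec_index v))"
      by (simp add: qpos_semidef_def del: of_real_diff)
    also have "\<dots> \<longleftrightarrow> (\<forall>c. ?t c \<le> ?g c)"
    proof
      assume V: "\<forall>v\<in>carrier_vec r. ?t (vec_index v) \<le> ?g (vec_index v)"
      show "\<forall>c. ?t c \<le> ?g c"
      proof
        fix c
        have "kernel_seq r b q (vec_index (vec r c)) = kernel_seq r b q c" for b
          by (simp add: kernel_seq_def fun_eq_iff)
        then show "?t c \<le> ?g c" using V[rule_format, of "vec r c"] by simp
      qed
    qed blast
    finally show ?thesis .
  qed
  then show ?thesis
    unfolding positive_kernel_def by simp
qed

text \<open>The adjoint Toeplitz matrices of size \<open>n\<close>, applied to the truncation of \<open>g\<close>, converge entrywise to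
  \<open>t\<close> as \<open>n\<close> grows, because the series of \<open>S\<close> converges at each \<open>q i\<close>.\<close>

theorem toeplitz_contractive_imp_positive_kernel:
  assumes s: "has_coeffs S s" and tc: "toeplitz_contractive s"
  shows "positive_kernel \<bool> (schur_kernel S)"
  unfolding positive_schur_kernel_iff
proof (intro allI impI)
  fix r and q c :: "nat \<Rightarrow> quat"
  assume "\<forall>i<r. norm (q i) < 1"
  then have q: "\<And>i. i < r \<Longrightarrow> norm (q i) < 1" by simp
  define g where "g = kernel_seq r (\<lambda>_. 1) q c"
  define t where "t = kernel_seq r (\<lambda>i. qcnj (S (q i))) q c"
  have sg: "summable (\<lambda>k. (norm (g k))\<^sup>2)" and st: "summable (\<lambda>k. (norm (t k))\<^sup>2)"
    unfolding g_def t_def by (intro kernel_seq_summable_sq q; assumption)+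
  define h where "h = (\<lambda>n k. \<Sum>i<n. qcnj (if k \<le> i then s (i - k) else 0) * g i)"
  have h: "(\<lambda>n. h n k) \<longlonglongrightarrow> t k" for k
  proof -
    have "(\<lambda>m. qcnj (s m) * g (m + k)) sums t k"
    proof -
      have "(\<lambda>m. qcnj (s m) * qcnj (q i) ^ m) sums qcnj (S (q i))" if "i < r" for i
      proof -
        have "(\<lambda>m. q i ^ m * s m) sums S (q i)" using s q[OF that] by (simp add: has_coeffs_def)
        from bounded_linear.sums[OF bounded_linear_qcnj this] show ?thesis
          by (simp add: qcnj_mult qcnj_power)
      qed
      then have "(\<lambda>m. \<Sum>i<r. qcnj (s m) * qcnj (q i) ^ m * qcnj (q i) ^ k * c i) sums
          (\<Sum>i<r. qcnj (S (q i)) * qcnj (q i) ^ k * c i)"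
        by (intro sums_sum sums_mult2) auto
      then show ?thesis
        by (simp add: g_def t_def kernel_seq_def sum_distrib_left power_add mult.assoc)
    qed
    then have "(\<lambda>i. qcnj (if k \<le> i then s (i - k) else 0) * g i) sums t k"
      by (subst sums_zero_iff_shift[of k, symmetric]) auto
    then show ?thesis by (simp add: sums_def h_def)
  qed
  have "(\<Sum>k<K. (norm (t k))\<^sup>2) \<le> (\<Sum>k. (norm (g k))\<^sup>2)" for K
  proof (rule tendsto_upperbound)
    show "(\<lambda>n. \<Sum>k<K. (norm (h n k))\<^sup>2) \<longlonglongrightarrow> (\<Sum>k<K. (norm (t k))\<^sup>2)"
      by (intro tendsto_intros h)
    show "\<forall>\<^sub>F n in sequentially. (\<Sum>k<K. (norm (h n k))\<^sup>2) \<le> (\<Sum>k. (norm (g k))\<^sup>2)"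
      using eventually_ge_at_top[of K]
    proof eventually_elim
      case (elim n)
      have "(\<Sum>k<K. (norm (h n k))\<^sup>2) \<le> (\<Sum>k<n. (norm (h n k))\<^sup>2)"
        using elim by (intro sum_mono2) auto
      also have "\<dots> \<le> (\<Sum>k<n. (norm (g k))\<^sup>2)"
        using tc unfolding toeplitz_contractive_iff_adjoint h_def by blast
      also have "\<dots> \<le> (\<Sum>k. (norm (g k))\<^sup>2)"
        by (rule sum_le_suminf[OF sg]) auto
      finally show ?case .
    qed
  qed simp
  then have "(\<Sum>k. (norm (t k))\<^sup>2) \<le> (\<Sum>k. (norm (g k))\<^sup>2)"
    by (intro suminf_le_const[OF st])
  then show "(\<Sum>k. (norm (kernel_seq r (\<lambda>i. qcnj (S (q i))) q c k))\<^sup>2) \<le> (\<Sum>k. (norm (kernel_seq r (\<lambda>_. 1) q c k))\<^sup>2)"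
    by (simp add: g_def t_def)
qed

section \<open>Positivity forces a power series\<close>

text \<open>Stated through finite sections, so that it is meaningful for every sequence and includes square
  summability.\<close>

definition l2_norm_le :: "(nat \<Rightarrow> quat) \<Rightarrow> real \<Rightarrow> bool" where
  "l2_norm_le g C \<longleftrightarrow> (\<forall>m. L2_set (\<lambda>k. norm (g k)) {..<m} \<le> C)"

lemma l2_norm_le_add:
  assumes "l2_norm_le g C" "l2_norm_le h D"
  shows "l2_norm_le (\<lambda>k. g k + h k) (C + D)"
  unfolding l2_norm_le_def
proof
  fix m
  have "L2_set (\<lambda>k. norm (g k + h k)) {..<m} \<le> L2_set (\<lambda>k. norm (g k) + norm (h k)) {..<m}"
    by (rule L2_set_mono) (auto intro: norm_triangle_ineq)
  also have "\<dots> \<le> L2_set (\<lambda>k. norm (g k)) {..<m} + L2_set (\<lambda>k. norm (h k)) {..<m}"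
    by (rule L2_set_triangle_ineq)
  also have "\<dots> \<le> C + D"
    using assms by (auto simp: l2_norm_le_def intro: add_mono)
  finally show "L2_set (\<lambda>k. norm (g k + h k)) {..<m} \<le> C + D" .
qed

lemma l2_norm_le_mult_right:
  assumes "l2_norm_le g C"
  shows "l2_norm_le (\<lambda>k. g k * c) (C * norm c)"
  using assms by (auto simp: l2_norm_le_def norm_mult L2_set_left_distrib[symmetric] intro: mult_right_mono)

lemma l2_norm_le_sum:
  assumes "finite A" "\<And>n. n \<in> A \<Longrightarrow> l2_norm_le (g n) (C n)"
  shows "l2_norm_le (\<lambda>k. \<Sum>n\<in>A. g n k) (\<Sum>n\<in>A. C n)"
  using assms
proof (induction A rule: finite_induct)
  case empty
  then show ?case by (simp add: l2_norm_le_def L2_set_def)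
next
  case (insert x F)
  then show ?case using l2_norm_le_add[of "g x" "C x" "\<lambda>k. \<Sum>n\<in>F. g n k" "sum C F"] by simp
qed

lemma l2_norm_le_abs_sum:
  assumes "summable (\<lambda>k. norm (g k))" "(\<Sum>k. norm (g k)) \<le> C"
  shows "l2_norm_le g C"
  unfolding l2_norm_le_def
proof
  fix m
  have "L2_set (\<lambda>k. norm (g k)) {..<m} \<le> (\<Sum>k<m. norm (g k))"
    by (rule L2_set_le_sum) simp
  also have "\<dots> \<le> (\<Sum>k. norm (g k))"
    by (rule sum_le_suminf[OF assms(1)]) auto
  finally show "L2_set (\<lambda>k. norm (g k)) {..<m} \<le> C" using assms(2) by simp
qed

text \<open>Relates the coefficient sequence of a finite combination of kernels to the same combination of
  the conjugated values of \<open>S\<close>. A relation is used because the second depends only on the first once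
  the kernel is known to be positive (\<open>norm_kernel_comb_le\<close>).\<close>

inductive kernel_comb :: "(quat \<Rightarrow> quat) \<Rightarrow> (nat \<Rightarrow> quat) \<Rightarrow> quat \<Rightarrow> bool" for S where
  zero: "kernel_comb S (\<lambda>k. 0) 0"
| add_kernel: "kernel_comb S g \<tau> \<Longrightarrow> norm q < 1 \<Longrightarrow>
    kernel_comb S (\<lambda>k. g k + qcnj q ^ k * c) (\<tau> + qcnj (S q) * c)"

lemma kernel_comb_add:
  assumes "kernel_comb S g \<tau>" "kernel_comb S h \<sigma>"
  shows "kernel_comb S (\<lambda>k. g k + h k) (\<tau> + \<sigma>)"
  using assms(2)
proof induction
  case zero
  then show ?case using assms(1) by simp
next
  case (add_kernel h \<sigma> q c)
  then show ?case using kernel_comb.add_kernel[of S "\<lambda>k. g k + h k" "\<tau> + \<sigma>" q c] by (simp add: add.assoc)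
qed

lemma kernel_comb_mult_right:
  assumes "kernel_comb S g \<tau>"
  shows "kernel_comb S (\<lambda>k. g k * d) (\<tau> * d)"
  using assms
proof induction
  case zero
  then show ?case using kernel_comb.zero by simp
next
  case (add_kernel g \<tau> q c)
  then show ?case
    using kernel_comb.add_kernel[of S "\<lambda>k. g k * d" "\<tau> * d" q "c * d"] by (simp add: distrib_right mult.assoc)
qed

lemma kernel_comb_sum:
  assumes "finite A" "\<And>n. n \<in> A \<Longrightarrow> kernel_comb S (g n) (\<tau> n)"
  shows "kernel_comb S (\<lambda>k. \<Sum>n\<in>A. g n k) (\<Sum>n\<in>A. \<tau> n)"
  using assms
  by (induction A rule: finite_induct) (simp_all add: kernel_comb.zero kernel_comb_add)

lemma kernel_comb_kernel:
  "norm q < 1 \<Longrightarrow> kernel_comb S (\<lambda>k. qcnj q ^ k * c) (qcnj (S q) * c)"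
  using kernel_comb.add_kernel[OF kernel_comb.zero, of q S c] by simp

lemma kernel_comb_imp_kernel_seq:
  assumes "kernel_comb S g \<tau>"
  shows "\<exists>r q c. (\<forall>i<r. norm (q i) < 1) \<and> g = kernel_seq r (\<lambda>_. 1) q c \<and>
    \<tau> = kernel_seq r (\<lambda>i. qcnj (S (q i))) q c 0"
  using assms
proof induction
  case zero
  show ?case by (intro exI[of _ 0]) (simp add: kernel_seq_def fun_eq_iff)
next
  case (add_kernel g \<tau> p d)
  then obtain r q c where IH: "\<forall>i<r. norm (q i) < 1" "g = kernel_seq r (\<lambda>_. 1) q c"
    "\<tau> = kernel_seq r (\<lambda>i. qcnj (S (q i))) q c 0" by blast
  show ?case
    using IH(1) \<open>norm p < 1\<close>
    by (intro exI[of _ "Suc r"] exI[of _ "q(r := p)"] exI[of _ "c(r := d)"])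
      (simp add: IH(2,3) kernel_seq_def fun_eq_iff less_Suc_eq)
qed

text \<open>The value \<open>\<tau>\<close> is the zeroth entry of the sequence \<open>t\<close> whose square norm a positive kernel bounds by
  that of \<open>g\<close>.\<close>

lemma norm_kernel_comb_le:
  assumes K: "positive_kernel \<bool> (schur_kernel S)" and g: "kernel_comb S g \<tau>" "l2_norm_le g C"
  shows "norm \<tau> \<le> C"
proof -
  obtain r q c where q: "\<forall>i<r. norm (q i) < 1" and gr: "g = kernel_seq r (\<lambda>_. 1) q c"
    and \<tau>: "\<tau> = kernel_seq r (\<lambda>i. qcnj (S (q i))) q c 0"
    using kernel_comb_imp_kernel_seq[OF g(1)] by blast
  define t where "t = kernel_seq r (\<lambda>i. qcnj (S (q i))) q c"
  have sm: "summable (\<lambda>k. (norm (g k))\<^sup>2)" "summable (\<lambda>k. (norm (t k))\<^sup>2)"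
    unfolding gr t_def using q by (auto intro: kernel_seq_summable_sq)
  have "L2_set (\<lambda>k. norm (g k)) {..<0} \<le> C" using g(2) unfolding l2_norm_le_def by blast
  then have "0 \<le> C" by simp
  have "(norm \<tau>)\<^sup>2 = (\<Sum>k<1. (norm (t k))\<^sup>2)" by (simp add: \<tau> t_def)
  also have "\<dots> \<le> (\<Sum>k. (norm (t k))\<^sup>2)" by (rule sum_le_suminf[OF sm(2)]) auto
  also have "\<dots> \<le> (\<Sum>k. (norm (g k))\<^sup>2)"
    using K[unfolded positive_schur_kernel_iff] q unfolding gr t_def by blast
  also have "\<dots> \<le> C\<^sup>2"
  proof (rule suminf_le_const[OF sm(1)])
    fix m
    have "sqrt (\<Sum>k<m. (norm (g k))\<^sup>2) \<le> C"
      using g(2) by (simp add: l2_norm_le_def L2_set_def)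
    then show "(\<Sum>k<m. (norm (g k))\<^sup>2) \<le> C\<^sup>2"
      by (rule sqrt_le_D)
  qed
  finally show ?thesis using \<open>0 \<le> C\<close> by (simp add: power2_le_iff_abs_le)
qed

text \<open>The coefficient sequence of the \<open>n\<close>-th monomial is approximated by averaging the kernels at the
  points \<open>\<omega>\<^sup>j / 2\<close> against the \<open>n\<close>-th character. By orthogonality the average agrees with the
  monomial in all positions below \<open>N\<close>, and beyond that its entries are at most \<open>2\<^sup>n / 2\<^sup>k\<close>.\<close>

lemma kernel_comb_near_unit:
  assumes "e > 0"
  shows "\<exists>g \<tau>. kernel_comb S g \<tau> \<and> l2_norm_le (\<lambda>k. g k - (if k = n then 1 else 0)) e"
proof -
  have "(\<lambda>N. 2 ^ n * 2 * (1 / 2) ^ N :: real) \<longlonglongrightarrow> 2 ^ n * 2 * 0"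
    by (intro tendsto_mult_left LIMSEQ_power_zero) simp
  then have "\<forall>\<^sub>F N in sequentially. 2 ^ n * 2 * (1 / 2) ^ N < e"
    using assms by (intro order_tendstoD(2)) auto
  then have "\<forall>\<^sub>F N in sequentially. 2 ^ n * 2 * (1 / 2) ^ N < e \<and> n < N"
    using eventually_gt_at_top[of n] by eventually_elim simp
  then obtain N where N: "2 ^ n * 2 * (1 / 2) ^ N < e" "n < N"
    unfolding eventually_sequentially by blast
  then obtain \<omega> where \<omega>: "fourier_root N \<omega>" using fourier_root_exists[of N] by auto
  have n\<omega>: "norm \<omega> = 1" using \<omega> by (simp add: fourier_root_def)
  define q where "q = (\<lambda>j. (1 / 2) *\<^sub>R \<omega> ^ j)"
  define c where "c = (\<lambda>j. (2 ^ n / real N) *\<^sub>R \<omega> ^ (j * n))"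
  define g where "g = (\<lambda>k. \<Sum>j<N. qcnj (q j) ^ k * c j)"
  define \<tau> where "\<tau> = (\<Sum>j<N. qcnj (S (q j)) * c j)"
  have comb: "kernel_comb S g \<tau>"
    unfolding g_def \<tau>_def by (rule kernel_comb_sum) (simp_all add: kernel_comb_kernel q_def norm_power n\<omega>)
  have gk: "g k = (2 ^ n * (1 / 2) ^ k / real N) *\<^sub>R (\<Sum>j<N. \<omega> ^ (j * n) * qcnj \<omega> ^ (j * k))" for k
  proof -
    have "qcnj (q j) ^ k * c j = (2 ^ n * (1 / 2) ^ k / real N) *\<^sub>R (\<omega> ^ (j * n) * qcnj \<omega> ^ (j * k))" for j
      by (simp add: q_def c_def qcnj_scaleR qcnj_power scaleR_power qcnj_power_commute field_simps flip: power_mult)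
    then show ?thesis by (simp add: g_def scaleR_sum_right)
  qed
  have small: "g k - (if k = n then 1 else 0) = 0" if "k < N" for k
  proof -
    have "2 ^ n * (1 / 2) ^ n = (1 :: real)" by (simp flip: power_mult_distrib)
    then have "g n = (1 / real N) *\<^sub>R of_nat N"
      using \<omega> N(2) by (simp only: gk fourier_root_def) simp
    also have "(of_nat N :: quat) = real N *\<^sub>R 1" by (simp add: scaleR_conv_of_real)
    also have "(1 / real N) *\<^sub>R \<dots> = 1" using N(2) by simp
    finally have "g n = 1" .
    moreover have "g k = 0" if "k \<noteq> n"
      using \<omega> that \<open>k < N\<close> N(2) by (simp add: gk fourier_root_def)
    ultimately show ?thesis by simp
  qed
  have le: "norm (g k - (if k = n then 1 else 0)) \<le> 2 ^ n * (1 / 2) ^ k" if "k \<ge> N" for k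
  proof -
    have "norm (\<Sum>j<N. \<omega> ^ (j * n) * qcnj \<omega> ^ (j * k)) \<le> (\<Sum>j<N. 1)"
      by (rule sum_norm_le) (simp add: norm_mult norm_power n\<omega>)
    then have "norm (g k) \<le> 2 ^ n * (1 / 2) ^ k / real N * real N"
      unfolding gk norm_scaleR by (intro mult_mono) auto
    then show ?thesis using that N by simp
  qed
  have sm: "summable (\<lambda>k. 2 ^ n * (1 / 2 :: real) ^ (k + N))"
    by (intro summable_mult summable_ignore_initial_segment summable_geometric) simp
  have sN: "summable (\<lambda>k. norm (g (k + N) - (if k + N = n then 1 else 0)))"
    by (rule summable_comparison_test'[OF sm, of 0]) (use le in auto)
  then have s: "summable (\<lambda>k. norm (g k - (if k = n then 1 else 0)))"
    by (rule summable_iff_shift[THEN iffD1])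
  have "(\<Sum>k. norm (g k - (if k = n then 1 else 0))) = (\<Sum>k. norm (g (k + N) - (if k + N = n then 1 else 0)))"
    using suminf_split_initial_segment[OF s, of N] small by simp
  also have "\<dots> \<le> (\<Sum>k. 2 ^ n * (1 / 2) ^ (k + N))"
    by (rule suminf_le[OF _ sN sm]) (use le in auto)
  also have "\<dots> = 2 ^ n * 2 * (1 / 2) ^ N"
    using sums_mult[OF geometric_sums[of "1 / 2 :: real"], of "2 ^ n * (1 / 2) ^ N"]
    by (simp add: power_add mult_ac sums_iff)
  also have "\<dots> \<le> e" using N by simp
  finally show ?thesis using comb l2_norm_le_abs_sum[OF s] by blast
qed

text \<open>The functional extends by continuity from combinations of kernels to the monomials; \<open>\<sigma> n\<close> is its
  value at the \<open>n\<close>-th one. The kernel at \<open>p\<close> is the norm convergent sum of the monomials with weights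
  the powers of the conjugate of \<open>p\<close>, and its value under the functional is the conjugate of
  \<open>S p\<close>. Continuity thus expands the conjugate of \<open>S p\<close> in powers of the conjugate of \<open>p\<close>.\<close>

theorem positive_kernel_imp_has_coeffs:
  assumes K: "positive_kernel \<bool> (schur_kernel S)"
  shows "\<exists>s. has_coeffs S s"
proof -
  define \<delta> where "\<delta> = (\<lambda>n k :: nat. if k = n then 1 else 0 :: quat)"
  have "\<forall>n i. \<exists>g \<tau>. kernel_comb S g \<tau> \<and> l2_norm_le (\<lambda>k. g k - \<delta> n k) (1 / real (Suc i))"
    unfolding \<delta>_def using kernel_comb_near_unit[of "1 / real (Suc _)" S] by simp
  then obtain G T where comb: "\<And>n i. kernel_comb S (G n i) (T n i)"
    and G: "\<And>n i. l2_norm_le (\<lambda>k. G n i k - \<delta> n k) (1 / real (Suc i))"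
    by metis
  \<comment> \<open>The difference of two approximants of the same monomial is again a small combination of kernels.\<close>
  have close: "norm (T n i - T n j) \<le> 1 / real (Suc i) + 1 / real (Suc j)" for n i j
  proof (rule norm_kernel_comb_le[OF K])
    show "kernel_comb S (\<lambda>k. G n i k + G n j k * (-1)) (T n i - T n j)"
      using kernel_comb_add[OF comb kernel_comb_mult_right[OF comb, of n j "-1"], of n i] by simp
    show "l2_norm_le (\<lambda>k. G n i k + G n j k * (-1)) (1 / real (Suc i) + 1 / real (Suc j))"
      using l2_norm_le_add[OF G l2_norm_le_mult_right[OF G, of n j "-1"], of n i] by (simp add: algebra_simps)
  qed
  have to0: "(\<lambda>i. 1 / real (Suc i)) \<longlonglongrightarrow> 0"
    by (rule LIMSEQ_Suc[OF lim_1_over_n])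
  have "\<exists>l. (\<lambda>i. T n i) \<longlonglongrightarrow> l" for n
  proof -
    have "Cauchy (\<lambda>i. T n i)"
    proof (rule CauchyI)
      fix e :: real assume "e > 0"
      then have "\<forall>\<^sub>F i in sequentially. 1 / real (Suc i) < e / 2"
        using order_tendstoD(2)[OF to0, of "e / 2"] by simp
      then obtain M where M: "\<And>i. i \<ge> M \<Longrightarrow> 1 / real (Suc i) < e / 2"
        unfolding eventually_sequentially by blast
      have "norm (T n i - T n j) < e" if "i \<ge> M" "j \<ge> M" for i j
        using close[of n i j] M[OF that(1)] M[OF that(2)] by linarith
      then show "\<exists>M. \<forall>m\<ge>M. \<forall>j\<ge>M. norm (T n m - T n j) < e" by blast
    qed
    then show ?thesis using Cauchy_convergent_iff unfolding convergent_def by blast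
  qed
  then obtain \<sigma> where \<sigma>: "\<And>n. (\<lambda>i. T n i) \<longlonglongrightarrow> \<sigma> n" by metis
  have "has_coeffs S (\<lambda>n. qcnj (\<sigma> n))"
    unfolding has_coeffs_def
  proof
    fix p assume "p \<in> \<bool>"
    then have p: "norm p < 1" by simp
    have bound: "norm (qcnj (S p) - (\<Sum>n<M. \<sigma> n * qcnj p ^ n)) \<le> norm p ^ M / (1 - norm p)" for M
    proof -
      \<comment> \<open>For fixed \<open>M\<close> the kernel at \<open>p\<close> minus the approximants of its first \<open>M\<close> terms splits into the
        tail of the kernel and the errors of the approximants.\<close>
      have step: "norm (qcnj (S p) - (\<Sum>n<M. T n i * qcnj p ^ n)) \<le>
          norm p ^ M / (1 - norm p) + (\<Sum>n<M. 1 / real (Suc i) * norm p ^ n)" for i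
      proof (rule norm_kernel_comb_le[OF K])
        have "kernel_comb S (\<lambda>k. \<Sum>n<M. G n i k * qcnj p ^ n) (\<Sum>n<M. T n i * qcnj p ^ n)"
          by (intro kernel_comb_sum kernel_comb_mult_right comb) simp
        from kernel_comb_add[OF kernel_comb_kernel[OF p, of S 1] kernel_comb_mult_right[OF this, of "-1"]]
        show "kernel_comb S (\<lambda>k. qcnj p ^ k - (\<Sum>n<M. G n i k * qcnj p ^ n))
            (qcnj (S p) - (\<Sum>n<M. T n i * qcnj p ^ n))"
          by simp
        have tail: "l2_norm_le (\<lambda>k. if k < M then 0 else qcnj p ^ k) (norm p ^ M / (1 - norm p))"
        proof (rule l2_norm_le_abs_sum)
          have "(\<lambda>k. norm p ^ M * norm p ^ k) sums (norm p ^ M * (1 / (1 - norm p)))"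
            using p by (intro sums_mult geometric_sums) simp
          then have "(\<lambda>k. norm (if k + M < M then 0 else qcnj p ^ (k + M))) sums (norm p ^ M / (1 - norm p))"
            by (simp add: norm_mult norm_power power_add mult.commute)
          then have "(\<lambda>k. norm (if k < M then 0 else qcnj p ^ k)) sums (norm p ^ M / (1 - norm p))"
            by (subst sums_zero_iff_shift[of M, symmetric]) auto
          then show "summable (\<lambda>k. norm (if k < M then 0 else qcnj p ^ k))"
            "(\<Sum>k. norm (if k < M then 0 else qcnj p ^ k)) \<le> norm p ^ M / (1 - norm p)"
            by (simp_all add: sums_iff)
        qed
        have err: "l2_norm_le (\<lambda>k. \<Sum>n<M. (G n i k - \<delta> n k) * (- (qcnj p ^ n))) (\<Sum>n<M. 1 / real (Suc i) * norm (- (qcnj p ^ n)))"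
          by (intro l2_norm_le_sum l2_norm_le_mult_right G) simp
        show "l2_norm_le (\<lambda>k. qcnj p ^ k - (\<Sum>n<M. G n i k * qcnj p ^ n))
            (norm p ^ M / (1 - norm p) + (\<Sum>n<M. 1 / real (Suc i) * norm p ^ n))"
        proof -
          have "(\<Sum>n<M. \<delta> n k * qcnj p ^ n) = (if k < M then qcnj p ^ k else 0)" for k
            by (simp add: \<delta>_def if_distrib[of "\<lambda>x. x * _"] cong: if_cong)
          then have "(if k < M then 0 else qcnj p ^ k) + (\<Sum>n<M. (G n i k - \<delta> n k) * (- (qcnj p ^ n))) =
              qcnj p ^ k - (\<Sum>n<M. G n i k * qcnj p ^ n)" for k
            by (simp add: left_diff_distrib sum_subtractf sum_negf)
          then show ?thesis using l2_norm_le_add[OF tail err] by (simp add: norm_power)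
        qed
      qed
      have "(\<lambda>i. norm p ^ M / (1 - norm p) + (\<Sum>n<M. 1 / real (Suc i) * norm p ^ n)) \<longlonglongrightarrow>
          norm p ^ M / (1 - norm p) + (\<Sum>n<M. 0 * norm p ^ n)"
        by (intro tendsto_add tendsto_const tendsto_sum tendsto_mult_right to0)
      moreover have "(\<lambda>i. norm (qcnj (S p) - (\<Sum>n<M. T n i * qcnj p ^ n))) \<longlonglongrightarrow>
          norm (qcnj (S p) - (\<Sum>n<M. \<sigma> n * qcnj p ^ n))"
        by (intro tendsto_intros \<sigma>)
      ultimately show ?thesis
        using step by (intro LIMSEQ_le[of "\<lambda>i. norm (qcnj (S p) - (\<Sum>n<M. T n i * qcnj p ^ n))"]) auto
    qed
    have "(\<lambda>M. norm p ^ M / (1 - norm p)) \<longlonglongrightarrow> 0 / (1 - norm p)"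
      using p by (intro tendsto_divide LIMSEQ_power_zero tendsto_const) auto
    then have null: "(\<lambda>M. norm p ^ M / (1 - norm p)) \<longlonglongrightarrow> 0" by simp
    have "(\<lambda>M. qcnj (S p) - (\<Sum>n<M. \<sigma> n * qcnj p ^ n)) \<longlonglongrightarrow> 0"
      by (rule Lim_null_comparison[OF always_eventually[OF allI, OF bound] null])
    from tendsto_diff[OF tendsto_const[of "qcnj (S p)"] this]
    have "(\<lambda>n. \<sigma> n * qcnj p ^ n) sums qcnj (S p)" by (simp add: sums_def)
    from bounded_linear.sums[OF bounded_linear_qcnj this]
    show "(\<lambda>n. p ^ n * qcnj (\<sigma> n)) sums S p" by (simp add: qcnj_mult qcnj_power)
  qed
  then show ?thesis by blast
qed

text \<open>The case of a single point.\<close>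

lemma positive_kernel_imp_bounded:
  assumes K: "positive_kernel \<bool> (schur_kernel S)" and p: "norm p < 1"
  shows "norm (S p) \<le> 1"
proof -
  define G where "G = (\<Sum>k. (norm p ^ k)\<^sup>2)"
  have "kernel_seq 1 b (\<lambda>_. p) (\<lambda>_. 1) k = b 0 * qcnj p ^ k" for b k
    by (simp add: kernel_seq_def)
  then have "(\<Sum>k. (norm (qcnj (S p) * qcnj p ^ k))\<^sup>2) \<le> (\<Sum>k. (norm (1 * qcnj p ^ k))\<^sup>2)"
    using K[unfolded positive_schur_kernel_iff, rule_format, of 1 "\<lambda>_. p" "\<lambda>_. 1"] p by simp
  moreover have sm: "summable (\<lambda>k. (norm p ^ k)\<^sup>2)"
  proof -
    have "summable (\<lambda>k. ((norm p)\<^sup>2) ^ k)"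
      using p by (intro summable_geometric) (simp add: abs_square_less_1)
    then show ?thesis by (simp add: mult.commute flip: power_mult)
  qed
  ultimately have "(norm (S p))\<^sup>2 * G \<le> G"
    by (simp add: norm_mult norm_power power_mult_distrib suminf_mult G_def)
  moreover have "1 \<le> G"
    using sum_le_suminf[OF sm, of "{..<1}"] by (simp add: G_def)
  ultimately have "(norm (S p))\<^sup>2 \<le> 1" by simp
  then show ?thesis by (simp add: abs_square_le_1)
qed

theorem theorem3p3:
  fixes S :: "quat \<Rightarrow> quat"
  shows "((slice_regular_on S \<bool> \<and> (\<forall>p\<in>\<bool>. norm (S p) \<le> 1)) \<longleftrightarrow> hardy_contraction (star_prod S)) \<and>
    (hardy_contraction (star_prod S) \<longleftrightarrow> positive_kernel \<bool> (schur_kernel S)) \<and>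
    (positive_kernel \<bool> (schur_kernel S) \<longleftrightarrow>
      (slice_regular_on S \<bool> \<and>
       (\<forall>n. qpos_semidef (1\<^sub>m (n + 1) -
          lower_toeplitz (coeffs_of S) n * qadjoint (lower_toeplitz (coeffs_of S) n)))))"
proof -
  let ?TC = "\<exists>s. has_coeffs S s \<and> toeplitz_contractive s"
  have regular: "slice_regular_on S \<bool> \<longleftrightarrow> (\<exists>s. has_coeffs S s)"
    using slice_regular_imp_has_coeffs has_coeffs_imp_slice_regular by blast
  have positive_imp: "(\<exists>s. has_coeffs S s) \<and> (\<forall>p\<in>\<bool>. norm (S p) \<le> 1)"
    if "positive_kernel \<bool> (schur_kernel S)"
    using positive_kernel_imp_has_coeffs[OF that] positive_kernel_imp_bounded[OF that] by simp
  have bounded_imp: ?TC if "\<exists>s. has_coeffs S s" "\<forall>p\<in>\<bool>. norm (S p) \<le> 1"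
    using that bounded_imp_toeplitz_contractive by fastforce
  have contraction: "hardy_contraction (star_prod S) \<longleftrightarrow> ?TC"
    using toeplitz_contractive_imp_hardy_contraction hardy_contraction_imp_toeplitz_contractive by blast
  have TC_imp: "positive_kernel \<bool> (schur_kernel S)" if ?TC
    using that toeplitz_contractive_imp_positive_kernel by blast
  have matrices: "(slice_regular_on S \<bool> \<and> (\<forall>n. qpos_semidef (1\<^sub>m (n + 1) -
      lower_toeplitz (coeffs_of S) n * qadjoint (lower_toeplitz (coeffs_of S) n)))) \<longleftrightarrow> ?TC"
    unfolding regular toeplitz_contractive_iff_psd[symmetric] using coeffs_of_eq by metis
  show ?thesis
    unfolding matrices contraction unfolding regular using positive_imp bounded_imp TC_imp by blast
qed

end
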